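(* Suppose the underlying graph of an Adinkra with $N$ colors and vertex set $V$ is the quotient of the $N$-cube by a doubly even code $C\subseteq\mathbb{F}_2^N$ that does not contain the all-ones vector $\mathbf{1}=(1,\ldots,1)$. Then the invariant factors of the Adinkra (that is, of its signed Laplacian $L$) are $$(1^{\#V/2},\,(N^2-N)^{\#V/2}),$$ where exponents denote multiplicities.
   Context: A signed graph is a finite undirected simple graph $(V,E)$ with a signature $\mu:E\to\{-1,1\}$; edges with $\mu(e)=-1$ are called dashed, those with $\mu(e)=1$ solid. An Adinkra with $N\ge 1$ colors is a non-empty finite bipartite signed graph $(V,E,\mu)$, together with an assignment of one of $N$ colors to each edge and a function $h:V\to\mathbb{Z}$ (the function $h$ plays no role here), such that: (i) each vertex is incident to exactly $N$ edges, one of each color; (ii) for any two distinct colors, the subgraph consisting of all edges of those two colors is a disjoint union of $4$-cycles (called bicolor cycles); (iii) every bicolor cycle contains an odd number of dashed edges; (iv) $|h(v)-h(w)|=1$ for adjacent $v,w$. The signed Laplacian is $L=NI-A$, where $A_{ij}=\mu(e)$ if there is an edge $e$ between the $i$th and $j$th vertices and $0$ otherwise. A linear code of length $N$ is a linear subspace $C\subseteq\mathbb{F}_2^N$; it is doubly even if every element has weight (number of coordinates equal to $1$) divisible by $4$. The $N$-cube has vertex set $\mathbb{F}_2^N$, with an edge of color $i$ joining two vectors that differ exactly in coordinate $i$. The quotient of the $N$-cube by $C$ has vertex set $\mathbb{F}_2^N/C$, with an edge of color $j$ joining cosets $v+C$ and $w+C$ whenever some representatives are joined by an edge of color $j$ in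 the $N$-cube. The invariant factors of an integer square matrix are the nonnegative diagonal entries $d_1\mid d_2\mid\cdots$ of its Smith Normal Form over $\mathbb{Z}$, with multiplicity (entries may be $0$). *)

theory Defs
  imports
    "HOL-Analysis.Cartesian_Space"
    "HOL-Library.Z2"
    "HOL-Library.Disjoint_Sets"
    "Jordan_Normal_Form.Matrix"
begin

no_notation Matrix.vec_index (infixl "$" 100)

section \<open>Adinkras\<close>

locale signed_graph =
  fixes V :: "'v set" and E :: "'v set set" and \<mu> :: "'v set \<Rightarrow> int"
  assumes finite_V: "finite V"
    and edges: "\<And>e. e \<in> E \<Longrightarrow> \<exists>u\<in>V. \<exists>v\<in>V. u \<noteq> v \<and> e = {u, v}"
    and signature: "\<And>e. e \<in> E \<Longrightarrow> \<mu> e \<in> {-1, 1}"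

definition bipartite :: "'v set \<Rightarrow> 'v set set \<Rightarrow> bool" where
  "bipartite V E \<longleftrightarrow>
     (\<exists>X Y. X \<union> Y = V \<and> X \<inter> Y = {} \<and> (\<forall>e\<in>E. \<exists>x\<in>X. \<exists>y\<in>Y. e = {x, y}))"

definition four_cycle :: "'v set set \<Rightarrow> bool" where
  "four_cycle Z \<longleftrightarrow>
     (\<exists>a b c d. distinct [a, b, c, d] \<and> Z = {{a, b}, {b, c}, {c, d}, {d, a}})"

definition disjoint_union_of_four_cycles :: "'v set set \<Rightarrow> bool" where
  "disjoint_union_of_four_cycles S \<longleftrightarrow>
     (\<exists>F. (\<forall>Z\<in>F. four_cycle Z) \<and> disjoint_family_on Union F \<and> \<Union>F = S)"

definition bicolor_edges :: "'v set set \<Rightarrow> ('v set \<Rightarrow> 'n) \<Rightarrow> 'n \<Rightarrow> 'n \<Rightarrow> 'v set set" where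
  "bicolor_edges E color i j = {e \<in> E. color e = i \<or> color e = j}"

text \<open>The colors are the elements of a finite type \<open>'n\<close>, so the number of colors is
  \<open>N = CARD('n) \<ge> 1\<close>.\<close>

locale adinkra = signed_graph V E \<mu>
  for V :: "'v set" and E :: "'v set set" and \<mu> :: "'v set \<Rightarrow> int" +
  fixes color :: "'v set \<Rightarrow> 'n::finite" and h :: "'v \<Rightarrow> int"
  assumes V_nonempty: "V \<noteq> {}"
    and bipartite: "bipartite V E"
    and one_edge_per_color: "\<And>v i. v \<in> V \<Longrightarrow> \<exists>!e. e \<in> E \<and> v \<in> e \<and> color e = i"
    and bicolor_cycles:
      "\<And>i j. i \<noteq> j \<Longrightarrow> disjoint_union_of_four_cycles (bicolor_edges E color i j)"
    and odd_dashed: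
      "\<And>i j Z. i \<noteq> j \<Longrightarrow> four_cycle Z \<Longrightarrow> Z \<subseteq> bicolor_edges E color i j
         \<Longrightarrow> odd (card {e \<in> Z. \<mu> e = -1})"
    and height: "\<And>v w. {v, w} \<in> E \<Longrightarrow> \<bar>h v - h w\<bar> = 1"

text \<open>Matrices of a graph are formed with respect to a list \<open>vs\<close> enumerating the vertices.\<close>

definition signed_adjacency :: "'v set set \<Rightarrow> ('v set \<Rightarrow> int) \<Rightarrow> 'v list \<Rightarrow> int mat" where
  "signed_adjacency E \<mu> vs = Matrix.mat (length vs) (length vs)
     (\<lambda>(i, j). if {vs ! i, vs ! j} \<in> E then \<mu> {vs ! i, vs ! j} else 0)"

definition signed_laplacian ::
    "nat \<Rightarrow> 'v set set \<Rightarrow> ('v set \<Rightarrow> int) \<Rightarrow> 'v list \<Rightarrow> int mat" where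
  "signed_laplacian N E \<mu> vs = int N \<cdot>\<^sub>m 1\<^sub>m (length vs) - signed_adjacency E \<mu> vs"

section \<open>Binary codes and quotients of the cube\<close>

definition weight :: "bit ^ 'n \<Rightarrow> nat" where
  "weight x = card {i. x $ i = 1}"

definition doubly_even_code :: "(bit ^ 'n::finite) set \<Rightarrow> bool" where
  "doubly_even_code C \<longleftrightarrow> vec.subspace C \<and> (\<forall>c\<in>C. 4 dvd weight c)"

definition cube_adj :: "'n \<Rightarrow> bit ^ 'n \<Rightarrow> bit ^ 'n \<Rightarrow> bool" where
  "cube_adj i x y \<longleftrightarrow> (\<forall>k. x $ k \<noteq> y $ k \<longleftrightarrow> k = i)"

definition cosets :: "(bit ^ 'n) set \<Rightarrow> (bit ^ 'n) set set" where
  "cosets C = range (\<lambda>x. (+) x ` C)"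

definition quotient_adj ::
    "(bit ^ 'n) set \<Rightarrow> 'n \<Rightarrow> (bit ^ 'n) set \<Rightarrow> (bit ^ 'n) set \<Rightarrow> bool" where
  "quotient_adj C j X Y \<longleftrightarrow>
     X \<in> cosets C \<and> Y \<in> cosets C \<and> (\<exists>x\<in>X. \<exists>y\<in>Y. cube_adj j x y)"

text \<open>Being the quotient means being isomorphic to it as an edge-colored graph.\<close>

definition is_cube_quotient ::
    "'v set \<Rightarrow> 'v set set \<Rightarrow> ('v set \<Rightarrow> 'n) \<Rightarrow> (bit ^ 'n) set \<Rightarrow> bool" where
  "is_cube_quotient V E color C \<longleftrightarrow>
     (\<exists>f. bij_betw f V (cosets C) \<and>
       (\<forall>v\<in>V. \<forall>w\<in>V. \<forall>j. {v, w} \<in> E \<and> color {v, w} = j \<longleftrightarrow> quotient_adj C j (f v) (f w)))"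

section \<open>Smith normal form\<close>

text \<open>Over the integers, \<^const>\<open>invertible_mat\<close> means unimodular.  The list \<open>ds\<close> below is
  uniquely determined by \<open>A\<close>; it lists the invariant factors with multiplicity.\<close>

definition has_invariant_factors :: "int mat \<Rightarrow> int list \<Rightarrow> bool" where
  "has_invariant_factors A ds \<longleftrightarrow>
     (let n = length ds in A \<in> carrier_mat n n \<and>
       (\<exists>P \<in> carrier_mat n n. \<exists>Q \<in> carrier_mat n n. invertible_mat P \<and> invertible_mat Q \<and>
         P * A * Q = mat_diag n (\<lambda>i. ds ! i)) \<and>
       (\<forall>d\<in>set ds. 0 \<le> d) \<and>
       (\<forall>i. Suc i < n \<longrightarrow> ds ! i dvd ds ! Suc i))"

end

theory Submission
  imports Defs
    "Jordan_Normal_Form.Determinant"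
    "Jordan_Normal_Form.Column_Operations"
begin

no_notation Matrix.vec_index (infixl "$" 100)

text \<open>
  Let \<open>A\<close> be the signed adjacency matrix and \<open>L = N - A\<close>.  The matrices \<open>A\<^sub>i\<close> of the single colors are
  signed permutation matrices that square to \<open>1\<close> and, because every bicolor cycle has an odd number
  of dashed edges, anticommute pairwise.  Hence their sum \<open>A\<close> satisfies \<open>A\<^sup>2 = N\<close>, and
  \<open>(N - A) * (N + A) = m\<close> for \<open>m = N\<^sup>2 - N\<close>.  So every invariant factor of \<open>L\<close> divides \<open>m\<close>; it remains
  to see that only \<open>1\<close> and \<open>m\<close> occur, equally often.

  The main point is an integral contracting homotopy, a matrix \<open>W\<close> with \<open>W * A + A * W = 1\<close>.  A single
  color gives \<open>A\<^sub>i * A + A * A\<^sub>i = 2\<close>, which would suffice away from the prime \<open>2\<close>.  The hypothesis on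
  the code supplies the missing odd number.  As the all-ones vector is not in \<open>C\<close>, some linear
  functional vanishes on \<open>C\<close> and takes the value \<open>1\<close> there; in other words, the dual code contains a word
  of odd weight \<open>k\<close>, with support \<open>U\<close>, say.  This functional descends to a grading \<open>g\<close> of the vertices with values in
  \<open>{0, 1}\<close>, which changes along the edges with color in \<open>U\<close> and along no others.  With \<open>B\<close> the sum of
  the \<open>A\<^sub>i\<close> over \<open>i \<in> U\<close> and \<open>g\<close> also denoting the diagonal matrix of its values, the anticommutation
  relations give \<open>(g * B) * A + A * (g * B) = k\<close>.  Writing \<open>k = 2 * t + 1\<close>, one takes
  \<open>W = g * B - t * A\<^sub>i\<close> for any color \<open>i\<close> (\<open>homotopy_contracts\<close>).

  The homotopy yields \<open>L + L * W * L = m * W\<close>.  In Smith normal form this says that each invariant factor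
  \<open>d\<close> is coprime to its complement \<open>m / d\<close>.  A bipartition conjugates \<open>A\<close> to \<open>- A\<close>, hence \<open>N - A\<close> to
  \<open>N + A\<close>, so the product of the invariant factors equals the product of their
  complements.  For a divisor chain these two facts leave only the value \<open>1\<close> in the first half and \<open>m\<close> in
  the second half (\<open>coprime_complement_chain\<close>, \<open>smith_form_of_shifted_root\<close>).  The argument cancels the
  invariant factors, so \<open>N = 1\<close>, where \<open>m = 0\<close> and the graph is a single edge, is treated directly.
\<close>

section \<open>Smith normal form over the integers\<close>

text \<open>The two-sided inverse is kept inside the carrier, which spares every later use a
  derivation of the dimensions of the inverse.\<close>

definition unimodular :: "nat \<Rightarrow> int mat \<Rightarrow> bool" where
  "unimodular n P \<longleftrightarrow>
     P \<in> carrier_mat n n \<and> (\<exists>P' \<in> carrier_mat n n. P * P' = 1\<^sub>m n \<and> P' * P = 1\<^sub>m n)"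

definition unimod_equiv :: "nat \<Rightarrow> int mat \<Rightarrow> int mat \<Rightarrow> bool" where
  "unimod_equiv n A B \<longleftrightarrow> (\<exists>P Q. unimodular n P \<and> unimodular n Q \<and> P * A * Q = B)"

lemma unimodular_carrier: "unimodular n P \<Longrightarrow> P \<in> carrier_mat n n"
  by (simp add: unimodular_def)

lemma unimodularI:
  "P \<in> carrier_mat n n \<Longrightarrow> P' \<in> carrier_mat n n \<Longrightarrow> P * P' = 1\<^sub>m n \<Longrightarrow> P' * P = 1\<^sub>m n
    \<Longrightarrow> unimodular n P"
  by (auto simp: unimodular_def)

lemma unimodular_invertible_mat: "unimodular n P \<Longrightarrow> invertible_mat P"
  by (auto simp: unimodular_def invertible_mat_def inverts_mat_def)

lemma unimodular_one: "unimodular n (1\<^sub>m n)"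
  by (rule unimodularI[of _ _ "1\<^sub>m n"]) auto

lemma unimodular_mult:
  assumes "unimodular n P" "unimodular n Q"
  shows "unimodular n (P * Q)"
proof -
  obtain P' Q' where P: "P \<in> carrier_mat n n" "P' \<in> carrier_mat n n" "P * P' = 1\<^sub>m n" "P' * P = 1\<^sub>m n"
    and Q: "Q \<in> carrier_mat n n" "Q' \<in> carrier_mat n n" "Q * Q' = 1\<^sub>m n" "Q' * Q = 1\<^sub>m n"
    using assms unfolding unimodular_def by blast
  have "P * Q * (Q' * P') = P * (Q * Q') * P'"
    using P(1,2) Q(1,2) by (simp add: assoc_mult_mat[of _ n n _ n _ n])
  moreover have "Q' * P' * (P * Q) = Q' * (P' * P) * Q"
    using P(1,2) Q(1,2) by (simp add: assoc_mult_mat[of _ n n _ n _ n])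
  ultimately show ?thesis
    using P Q by (intro unimodularI[of _ _ "Q' * P'"]) auto
qed

lemma unimodular_swaprows_mat: "k < n \<Longrightarrow> l < n \<Longrightarrow> unimodular n (swaprows_mat n k l)"
  by (rule unimodularI[of _ _ "swaprows_mat n k l"]) (simp_all add: swaprows_mat_inv)

lemma unimodular_addrow_mat:
  "k < n \<Longrightarrow> l < n \<Longrightarrow> k \<noteq> l \<Longrightarrow> unimodular n (addrow_mat n a k l)"
  by (rule unimodularI[of _ _ "addrow_mat n (- a) k l"])
    (simp_all add: addrow_mat_inv addrow_mat_inv[of _ _ _ "-a", simplified])

lemma unimodular_diag_block:
  assumes "unimodular n P"
  shows "unimodular (Suc n) (four_block_mat (1\<^sub>m 1) (0\<^sub>m 1 n) (0\<^sub>m n 1) P)" (is "unimodular _ (?F P)")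
proof -
  obtain P' where P: "P \<in> carrier_mat n n" "P' \<in> carrier_mat n n" "P * P' = 1\<^sub>m n" "P' * P = 1\<^sub>m n"
    using assms unfolding unimodular_def by blast
  have F: "?F X * ?F Y = ?F (X * Y)" if "X \<in> carrier_mat n n" "Y \<in> carrier_mat n n" for X Y
    using that by (subst mult_four_block_mat[of _ 1 1 _ n _ n _ _ 1 _ n]) auto
  have "?F P * ?F P' = 1\<^sub>m (Suc n)" "?F P' * ?F P = 1\<^sub>m (Suc n)"
    using P by (simp_all add: F plus_1_eq_Suc del: One_nat_def)
  moreover have "?F P \<in> carrier_mat (Suc n) (Suc n)" "?F P' \<in> carrier_mat (Suc n) (Suc n)"
    using P four_block_carrier_mat[of "1\<^sub>m 1" 1 1 _ n n] by simp_all
  ultimately show ?thesis by (intro unimodularI[of _ _ "?F P'"])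
qed

lemma uminus_r_inv_mat:
  "(A :: 'a :: group_add mat) \<in> carrier_mat nr nc \<Longrightarrow> A + - A = 0\<^sub>m nr nc"
  by (intro eq_matI) auto

text \<open>For a suitable \<open>X\<close>, left multiplication by this block matrix clears the first column below
  a pivot that divides it; right multiplication by the transposed shape clears the first row.\<close>

lemma unimodular_lower_block:
  assumes X: "X \<in> carrier_mat n 1"
  shows "unimodular (Suc n) (four_block_mat (1\<^sub>m 1) (0\<^sub>m 1 n) X (1\<^sub>m n))"
    (is "unimodular _ (?F X)")
proof -
  have F: "?F X * ?F Y = ?F (X + Y)" if "X \<in> carrier_mat n 1" "Y \<in> carrier_mat n 1" for X Y
    using that by (subst mult_four_block_mat[of _ 1 1 _ n _ n _ _ 1 _ n]) auto
  have zero: "?F (0\<^sub>m n 1) = 1\<^sub>m (Suc n)"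
    by (rule eq_matI) auto
  have "?F X * ?F (- X) = 1\<^sub>m (Suc n)" "?F (- X) * ?F X = 1\<^sub>m (Suc n)"
    using F[of X "- X"] F[of "- X" X] X
    unfolding uminus_carrier_iff_mat uminus_r_inv_mat[OF X] uminus_l_inv_mat[OF X] zero by blast+
  moreover have "?F X \<in> carrier_mat (Suc n) (Suc n)" "?F (- X) \<in> carrier_mat (Suc n) (Suc n)"
    using four_block_carrier_mat[of "1\<^sub>m 1" 1 1 "1\<^sub>m n" n n] by simp_all
  ultimately show ?thesis by (intro unimodularI[of _ _ "?F (- X)"])
qed

lemma unimodular_upper_block:
  assumes X: "X \<in> carrier_mat 1 n"
  shows "unimodular (Suc n) (four_block_mat (1\<^sub>m 1) X (0\<^sub>m n 1) (1\<^sub>m n))" (is "unimodular _ (?F X)")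
proof -
  have F: "?F X * ?F Y = ?F (Y + X)" if "X \<in> carrier_mat 1 n" "Y \<in> carrier_mat 1 n" for X Y
    using that by (subst mult_four_block_mat[of _ 1 1 _ n _ n _ _ 1 _ n]) auto
  have zero: "?F (0\<^sub>m 1 n) = 1\<^sub>m (Suc n)"
    by (rule eq_matI) auto
  have "?F X * ?F (- X) = 1\<^sub>m (Suc n)" "?F (- X) * ?F X = 1\<^sub>m (Suc n)"
    using F[of X "- X"] F[of "- X" X] X
    unfolding uminus_carrier_iff_mat uminus_r_inv_mat[OF X] uminus_l_inv_mat[OF X] zero by blast+
  moreover have "?F X \<in> carrier_mat (Suc n) (Suc n)" "?F (- X) \<in> carrier_mat (Suc n) (Suc n)"
    using four_block_carrier_mat[of "1\<^sub>m 1" 1 1 "1\<^sub>m n" n n] by simp_all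
  ultimately show ?thesis by (intro unimodularI[of _ _ "?F (- X)"])
qed

lemma unimod_equiv_refl: "A \<in> carrier_mat n n \<Longrightarrow> unimod_equiv n A A"
  unfolding unimod_equiv_def using unimodular_one[of n]
  by (intro exI[of _ "1\<^sub>m n"]) auto

lemma unimod_equiv_carrier: "unimod_equiv n A B \<Longrightarrow> B \<in> carrier_mat n n"
  unfolding unimod_equiv_def carrier_mat_def
  using unimodular_carrier unfolding carrier_mat_def by auto

lemma unimod_equiv_mult:
  assumes "unimod_equiv n A B" "A \<in> carrier_mat n n" "unimodular n P" "unimodular n Q"
  shows "unimod_equiv n A (P * B * Q)"
proof -
  obtain R S where RS: "unimodular n R" "unimodular n S" "R * A * S = B"
    using assms(1) unfolding unimod_equiv_def by blast
  have "P * B * Q = (P * R) * A * (S * Q)"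
    using assms(2) RS(1,2) assms(3,4)[THEN unimodular_carrier] RS(1,2)[THEN unimodular_carrier]
    unfolding RS(3)[symmetric] by (simp add: assoc_mult_mat[of _ n n _ n _ n])
  then show ?thesis
    unfolding unimod_equiv_def using RS(1,2) assms(3,4) unimodular_mult by metis
qed

context
  fixes n :: nat and A B :: "int mat"
  assumes A: "A \<in> carrier_mat n n" and AB: "unimod_equiv n A B"
begin

lemma unimod_equiv_left: "unimodular n P \<Longrightarrow> unimod_equiv n A (P * B)"
  using unimod_equiv_mult[OF AB A _ unimodular_one, of P] unimod_equiv_carrier[OF AB]
  by (auto dest: unimodular_carrier)

lemma unimod_equiv_right: "unimodular n P \<Longrightarrow> unimod_equiv n A (B * P)"
  using unimod_equiv_mult[OF AB A unimodular_one, of P] unimod_equiv_carrier[OF AB]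
  by (auto dest: unimodular_carrier)

lemma unimod_equiv_swaprows: "k < n \<Longrightarrow> l < n \<Longrightarrow> unimod_equiv n A (swaprows k l B)"
  using unimod_equiv_left[OF unimodular_swaprows_mat] unimod_equiv_carrier[OF AB]
  by (simp add: swaprows_mat)

lemma unimod_equiv_swapcols: "k < n \<Longrightarrow> l < n \<Longrightarrow> unimod_equiv n A (swapcols k l B)"
  using unimod_equiv_right[OF unimodular_swaprows_mat] unimod_equiv_carrier[OF AB]
  by (simp add: swapcols_mat)

lemma unimod_equiv_addrow:
  "k < n \<Longrightarrow> l < n \<Longrightarrow> k \<noteq> l \<Longrightarrow> unimod_equiv n A (addrow a k l B)"
  using unimod_equiv_left[OF unimodular_addrow_mat] unimod_equiv_carrier[OF AB]
  by (simp add: addrow_mat)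

lemma unimod_equiv_addcol:
  "k < n \<Longrightarrow> l < n \<Longrightarrow> k \<noteq> l \<Longrightarrow> unimod_equiv n A (addcol a k l B)"
  using unimod_equiv_right[OF unimodular_addrow_mat, of l k] unimod_equiv_carrier[OF AB]
  by (simp add: addcol_mat)

end

lemma dvd_entries_mult:
  fixes A B :: "int mat"
  assumes "A \<in> carrier_mat n n" "B \<in> carrier_mat n n" "i < n" "j < n"
    and "(\<forall>i<n. \<forall>j<n. c dvd A $$ (i, j)) \<or> (\<forall>i<n. \<forall>j<n. c dvd B $$ (i, j))"
  shows "c dvd (A * B) $$ (i, j)"
  using assms by (auto simp: scalar_prod_def intro!: dvd_sum)

lemma unimod_equiv_dvd_entries:
  assumes "A \<in> carrier_mat n n" "unimod_equiv n A B" "\<And>i j. i < n \<Longrightarrow> j < n \<Longrightarrow> c dvd A $$ (i, j)"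
    and "i < n" "j < n"
  shows "c dvd B $$ (i, j)"
proof -
  obtain P Q where PQ: "unimodular n P" "unimodular n Q" "P * A * Q = B"
    using assms(2) unfolding unimod_equiv_def by blast
  note carr = PQ(1,2)[THEN unimodular_carrier] assms(1)
  have "\<forall>i<n. \<forall>j<n. c dvd (P * A) $$ (i, j)"
    using assms(3) carr by (intro allI impI dvd_entries_mult[of _ n]) auto
  then show ?thesis
    unfolding PQ(3)[symmetric] using carr assms(4,5)
    by (intro dvd_entries_mult[of _ n]) (auto intro: mult_carrier_mat)
qed

text \<open>The source of all divisibility below: among the positive entries of all matrices
  equivalent to \<open>A\<close> there is a least one, and swaps move it to the corner.  A nonzero matrix does
  have such an entry, because negation is a unimodular operation.\<close>

lemma minimal_pivot:
  assumes A: "A \<in> carrier_mat n n" and nz: "A \<noteq> 0\<^sub>m n n"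
  obtains B where "unimod_equiv n A B" "0 < n" "B $$ (0, 0) > 0"
    "\<And>B' i j. unimod_equiv n A B' \<Longrightarrow> i < n \<Longrightarrow> j < n \<Longrightarrow> B' $$ (i, j) > 0
       \<Longrightarrow> B $$ (0, 0) \<le> B' $$ (i, j)"
proof -
  define good where "good d \<longleftrightarrow> d > 0 \<and>
    (\<exists>B i j. unimod_equiv n A B \<and> i < n \<and> j < n \<and> B $$ (i, j) = int d)" for d
  have "\<exists>d. good d"
  proof -
    obtain i j where ij: "i < n" "j < n" "A $$ (i, j) \<noteq> 0"
      using A nz by (metis carrier_matD eq_matI index_zero_mat)
    have "unimodular n (- 1\<^sub>m n)"
      by (rule unimodularI[of _ _ "- 1\<^sub>m n"]) auto
    then have "unimod_equiv n A (- 1\<^sub>m n * A)"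
      using unimod_equiv_left[OF A unimod_equiv_refl[OF A]] by blast
    moreover have "- 1\<^sub>m n * A = - A"
      using A by simp
    ultimately have "unimod_equiv n A (- A)" by simp
    moreover have "(- A) $$ (i, j) = - (A $$ (i, j))"
      using ij A by simp
    ultimately obtain B where "unimod_equiv n A B" "B $$ (i, j) = \<bar>A $$ (i, j)\<bar>"
      using unimod_equiv_refl[OF A] by (cases "A $$ (i, j) \<ge> 0") (auto simp: abs_if)
    then have "good (nat \<bar>A $$ (i, j)\<bar>)"
      using ij unfolding good_def by (intro conjI exI[of _ B] exI[of _ i] exI[of _ j]) auto
    then show ?thesis ..
  qed
  then have good: "good (LEAST d. good d)" and least: "\<And>d. good d \<Longrightarrow> (LEAST d. good d) \<le> d"
    by (auto intro: LeastI_ex Least_le)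
  obtain B i j where B: "unimod_equiv n A B" "i < n" "j < n" "B $$ (i, j) = int (LEAST d. good d)"
    using good unfolding good_def by blast
  have Bc: "B \<in> carrier_mat n n" and n: "0 < n"
    using B unimod_equiv_carrier by auto
  let ?C = "swaprows 0 i (swapcols 0 j B)"
  show thesis
  proof (rule that[of ?C])
    show "unimod_equiv n A ?C"
      using B n A by (intro unimod_equiv_swaprows unimod_equiv_swapcols) auto
    have eq: "?C $$ (0, 0) = int (LEAST d. good d)"
      using B Bc n by auto
    show "?C $$ (0, 0) > 0" using good eq unfolding good_def by simp
    fix B' i' j'
    assume "unimod_equiv n A B'" "i' < n" "j' < n" "B' $$ (i', j') > 0"
    then have "good (nat (B' $$ (i', j')))"
      unfolding good_def by (intro conjI exI[of _ B'] exI[of _ i'] exI[of _ j']) auto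
    from least[OF this] \<open>B' $$ (i', j') > 0\<close> show "?C $$ (0, 0) \<le> B' $$ (i', j')"
      unfolding eq by linarith
  qed (rule n)
qed

text \<open>A least positive corner entry \<open>d\<close> divides its row and its column, because adding a
  suitable multiple of the first column or row to another one would otherwise leave a positive
  remainder smaller than \<open>d\<close>.  Hence row and column can be cleared.  Every entry of the remaining block
  is divisible by \<open>d\<close> as well: adding its row to the first row does not change the corner and
  brings the entry into the first row.\<close>

lemma split_pivot:
  assumes A: "A \<in> carrier_mat (Suc k) (Suc k)" and nz: "A \<noteq> 0\<^sub>m (Suc k) (Suc k)"
  obtains d M where "d > 0" "M \<in> carrier_mat k k"
    "unimod_equiv (Suc k) A (four_block_mat (d \<cdot>\<^sub>m 1\<^sub>m 1) (0\<^sub>m 1 k) (0\<^sub>m k 1) M)"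
    "\<And>i j. i < k \<Longrightarrow> j < k \<Longrightarrow> d dvd M $$ (i, j)"
proof -
  obtain B where B: "unimod_equiv (Suc k) A B" "B $$ (0, 0) > 0"
    and min: "\<And>B' i j. unimod_equiv (Suc k) A B' \<Longrightarrow> i < Suc k \<Longrightarrow> j < Suc k \<Longrightarrow> B' $$ (i, j) > 0
       \<Longrightarrow> B $$ (0, 0) \<le> B' $$ (i, j)"
    by (rule minimal_pivot[OF A nz]) blast
  define d where "d = B $$ (0, 0)"
  have d: "d > 0" using B d_def by simp
  have Bc: "B \<in> carrier_mat (Suc k) (Suc k)"
    using B unimod_equiv_carrier by blast
  have small: "x = 0" if "unimod_equiv (Suc k) A B'" "i < Suc k" "j < Suc k" "B' $$ (i, j) = x"
    "0 \<le> x" "x < d" for B' i j x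
    using min[OF that(1-3)] that(4-6) unfolding d_def by linarith
  have row: "d dvd C $$ (0, j)" and col: "d dvd C $$ (j, 0)"
    if C: "unimod_equiv (Suc k) A C" "C $$ (0, 0) = d" "j < Suc k" for C j
  proof -
    have Cc: "C \<in> carrier_mat (Suc k) (Suc k)"
      using C unimod_equiv_carrier by blast
    show "d dvd C $$ (0, j)"
    proof (cases "j = 0")
      case False
      have "addcol (- (C $$ (0, j) div d)) j 0 C $$ (0, j) = C $$ (0, j) mod d"
        using Cc C(2,3) by (simp add: minus_div_mult_eq_mod [symmetric])
      from small[OF unimod_equiv_addcol[OF A C(1)] _ _ this] show ?thesis
        using False C d by auto
    qed (use C in simp)
    show "d dvd C $$ (j, 0)"
    proof (cases "j = 0")
      case False
      have "addrow (- (C $$ (j, 0) div d)) j 0 C $$ (j, 0) = C $$ (j, 0) mod d"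
        using Cc C(2,3) by (simp add: minus_div_mult_eq_mod [symmetric])
      from small[OF unimod_equiv_addrow[OF A C(1)] _ _ this] show ?thesis
        using False C d by auto
    qed (use C in simp)
  qed
  define r where "r = Matrix.mat 1 k (\<lambda>(i, j). B $$ (0, Suc j))"
  define c where "c = Matrix.mat k 1 (\<lambda>(i, j). B $$ (Suc i, 0))"
  define M where "M = Matrix.mat k k (\<lambda>(i, j). B $$ (Suc i, Suc j))"
  define X where "X = Matrix.mat k 1 (\<lambda>(i, j). - (B $$ (Suc i, 0) div d))"
  define Y where "Y = Matrix.mat 1 k (\<lambda>(i, j). - (B $$ (0, Suc j) div d))"
  define D :: "int mat" where "D = d \<cdot>\<^sub>m 1\<^sub>m 1"
  define M' where "M' = X * r + M"
  have cm: "r \<in> carrier_mat 1 k" "c \<in> carrier_mat k 1" "M \<in> carrier_mat k k"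
    "X \<in> carrier_mat k 1" "Y \<in> carrier_mat 1 k" "D \<in> carrier_mat 1 1" "M' \<in> carrier_mat k k"
    by (auto simp: r_def c_def M_def X_def Y_def D_def M'_def)
  have B_eq: "B = four_block_mat D r c M"
    using Bc by (intro eq_matI) (auto simp: d_def D_def r_def c_def M_def)
  have XD: "X * D + c = 0\<^sub>m k 1"
    using col[OF B(1) d_def[symmetric]]
    by (intro eq_matI) (auto simp: X_def D_def c_def)
  have DY: "D * Y + r = 0\<^sub>m 1 k"
    using row[OF B(1) d_def[symmetric]]
    by (intro eq_matI) (auto simp: Y_def D_def r_def)
  let ?C = "four_block_mat D (0\<^sub>m 1 k) (0\<^sub>m k 1) M'"
  have "four_block_mat (1\<^sub>m 1) (0\<^sub>m 1 k) X (1\<^sub>m k) * B = four_block_mat D r (0\<^sub>m k 1) M'"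
    unfolding B_eq using cm by (subst mult_four_block_mat[of _ 1 1 _ k _ k _ _ 1 _ k]) (auto simp: XD M'_def simp del: One_nat_def)
  moreover have "\<dots> * four_block_mat (1\<^sub>m 1) Y (0\<^sub>m k 1) (1\<^sub>m k) = ?C"
    using cm by (subst mult_four_block_mat[of _ 1 1 _ k _ k _ _ 1 _ k]) (auto simp: DY simp del: One_nat_def)
  ultimately have C: "unimod_equiv (Suc k) A ?C"
    using unimod_equiv_mult[OF B(1) A unimodular_lower_block unimodular_upper_block, of X Y] cm
    by simp
  have "d dvd M' $$ (i, j)" if "i < k" "j < k" for i j
  proof -
    let ?R = "addrow 1 0 (Suc i) ?C"
    have "unimod_equiv (Suc k) A ?R"
      using that by (intro unimod_equiv_addrow[OF A C]) auto
    moreover have "?R $$ (0, 0) = d" "?R $$ (0, Suc j) = M' $$ (i, j)"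
      using that carrier_matD[OF cm(6)] carrier_matD[OF cm(7)]
      by (auto simp: D_def)
    ultimately show ?thesis
      using row[of ?R "Suc j"] that by simp
  qed
  with that[OF d cm(7) C[unfolded D_def]] show thesis by simp
qed

text \<open>Induction on the dimension, splitting off one least pivot at a time.  The pivot divides the
  rest of the matrix, and equivalence preserves common divisors of all entries, so it divides the
  next diagonal entry.\<close>

theorem smith_normal_form_exists:
  assumes "A \<in> carrier_mat n n"
  shows "\<exists>d. unimod_equiv n A (mat_diag n d) \<and> (\<forall>i<n. 0 \<le> d i) \<and>
    (\<forall>i j. i \<le> j \<longrightarrow> j < n \<longrightarrow> d i dvd d j)"
  using assms
proof (induction n arbitrary: A)
  case 0
  then have "A = mat_diag 0 (\<lambda>_. 0)" by (intro eq_matI) (auto simp: mat_diag_def)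
  then show ?case using unimod_equiv_refl[OF 0] by auto
next
  case (Suc k)
  show ?case
  proof (cases "A = 0\<^sub>m (Suc k) (Suc k)")
    case True
    then have "A = mat_diag (Suc k) (\<lambda>_. 0)" by (intro eq_matI) (auto simp: mat_diag_def)
    then show ?thesis using unimod_equiv_refl[OF Suc.prems] by auto
  next
    case False
    obtain c M where c: "c > 0" and M: "M \<in> carrier_mat k k"
      and AM: "unimod_equiv (Suc k) A (four_block_mat (c \<cdot>\<^sub>m 1\<^sub>m 1) (0\<^sub>m 1 k) (0\<^sub>m k 1) M)"
      and dvd: "\<And>i j. i < k \<Longrightarrow> j < k \<Longrightarrow> c dvd M $$ (i, j)"
      by (rule split_pivot[OF Suc.prems False]) blast
    obtain d where Md: "unimod_equiv k M (mat_diag k d)" and d: "\<forall>i<k. 0 \<le> d i"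
      "\<forall>i j. i \<le> j \<longrightarrow> j < k \<longrightarrow> d i dvd d j"
      using Suc.IH[OF M] by (elim exE conjE) (rule that; assumption)
    obtain P Q where PQ: "unimodular k P" "unimodular k Q" "P * M * Q = mat_diag k d"
      using Md unfolding unimod_equiv_def by blast
    note carr = PQ(1,2)[THEN unimodular_carrier] M
    define f where "f i = (case i of 0 \<Rightarrow> c | Suc i \<Rightarrow> d i)" for i
    let ?F = "\<lambda>a X. four_block_mat (a \<cdot>\<^sub>m 1\<^sub>m 1) (0\<^sub>m 1 k) (0\<^sub>m k 1) X :: int mat"
    have F: "?F a X * ?F b Z = ?F (a * b) (X * Z)"
      if "X \<in> carrier_mat k k" "Z \<in> carrier_mat k k" for a b X Z
      using that by (subst mult_four_block_mat[of _ 1 1 _ k _ k _ _ 1 _ k]) auto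
    have one: "?F 1 X = four_block_mat (1\<^sub>m 1) (0\<^sub>m 1 k) (0\<^sub>m k 1) X" for X
      by (rule arg_cong[of _ _ "\<lambda>Z. four_block_mat Z _ _ _"]) auto
    have U: "unimodular (Suc k) (?F 1 P)" "unimodular (Suc k) (?F 1 Q)"
      unfolding one by (rule PQ(1,2)[THEN unimodular_diag_block])+
    have "?F 1 P * ?F c M * ?F 1 Q = ?F c (mat_diag k d)"
      using carr by (simp add: F PQ(3) del: One_nat_def)
    also have "\<dots> = mat_diag (Suc k) f"
      by (rule eq_matI) (auto simp: mat_diag_def f_def split: nat.splits)
    finally have "unimod_equiv (Suc k) A (mat_diag (Suc k) f)"
      using unimod_equiv_mult[OF AM Suc.prems U] by simp
    moreover have "\<forall>i<Suc k. 0 \<le> f i"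
      using c d(1) by (auto simp: f_def split: nat.splits)
    moreover have "f i dvd f j" if "i \<le> j" "j < Suc k" for i j
    proof -
      have "c dvd d j" if "j < k" for j
        using unimod_equiv_dvd_entries[OF M Md dvd that that] that by (simp add: mat_diag_def)
      with d(2) that show ?thesis by (auto simp: f_def split: nat.splits)
    qed
    ultimately show ?thesis by blast
  qed
qed

section \<open>Divisor chains with coprime complements\<close>

text \<open>Let \<open>g\<close> be the last \<open>d\<close> of the first half.  It divides \<open>h + 1\<close> of the \<open>d i\<close>, hence
  \<open>g ^ (h + 1)\<close> divides the product of all \<open>e i\<close>.  The factors \<open>e i\<close> with \<open>i \<ge> h - 1\<close> are coprime to
  \<open>g\<close>, and each of the other \<open>h - 1\<close> divides \<open>m = g * c\<close> with \<open>c\<close> coprime to \<open>g\<close>, so they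
  contribute at most \<open>g ^ (h - 1)\<close>.  This leaves only \<open>g = 1\<close>.\<close>

lemma coprime_complement_chain_first_half:
  fixes d e :: "nat \<Rightarrow> int"
  assumes de: "\<And>i. i < 2 * h \<Longrightarrow> d i * e i = m"
    and pos: "\<And>i. i < 2 * h \<Longrightarrow> 0 < d i"
    and cop: "\<And>i. i < 2 * h \<Longrightarrow> coprime (d i) (e i)"
    and chain: "\<And>i j. i \<le> j \<Longrightarrow> j < 2 * h \<Longrightarrow> d i dvd d j"
    and prod: "(\<Prod>i<2*h. d i) = (\<Prod>i<2*h. e i)"
    and i: "i < h"
  shows "d i = 1"
proof -
  define g c where "g = d (h - 1)" and "c = e (h - 1)"
  have gc: "coprime g c" "g * c = m" "g > 0"
    unfolding g_def c_def using cop de pos i by auto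
  have split: "{..<2*h} = {..<h-1} \<union> {h-1..<2*h}"
    using i by auto
  have "g ^ Suc h = (\<Prod>i\<in>{h-1..<2*h}. g)"
    using i by (simp del: power_Suc)
  also have "\<dots> dvd (\<Prod>i\<in>{h-1..<2*h}. d i)"
    unfolding g_def using chain by (intro prod_dvd_prod) auto
  also have "\<dots> dvd (\<Prod>i<2*h. d i)"
    unfolding split by (subst prod.union_disjoint) auto
  finally have "g ^ Suc h dvd (\<Prod>i<h-1. e i) * (\<Prod>i\<in>{h-1..<2*h}. e i)"
    unfolding prod unfolding split by (subst (asm) prod.union_disjoint) auto
  moreover have "coprime g (\<Prod>i\<in>{h-1..<2*h}. e i)"
  proof (rule prod_coprime_right)
    fix i assume "i \<in> {h-1..<2*h}"
    then show "coprime g (e i)"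
      unfolding g_def using coprime_divisors[OF chain dvd_refl cop] by simp
  qed
  ultimately have "g ^ Suc h dvd (\<Prod>i<h-1. e i)"
    by (metis coprime_dvd_mult_left_iff coprime_power_left_iff)
  also have "\<dots> dvd (\<Prod>i<h-1. m)"
  proof (rule prod_dvd_prod)
    fix i assume "i \<in> {..<h-1}"
    then show "e i dvd m" using de[of i, symmetric] i by (auto intro: dvd_triv_right[of "e i" "d i"])
  qed
  also have "\<dots> = g ^ (h - 1) * c ^ (h - 1)"
    by (simp add: gc(2)[symmetric] power_mult_distrib)
  finally have "g ^ Suc h dvd g ^ (h - 1)"
    using gc(1) by (metis coprime_dvd_mult_left_iff coprime_power_left_iff coprime_power_right_iff)
  then have "g ^ Suc h \<le> g ^ (h - 1)"
    using gc(3) by (intro zdvd_imp_le) auto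
  then have "\<not> g > 1"
    using power_strict_increasing[of "h - 1" "Suc h" g] by (auto simp del: power_Suc)
  then have "g = 1" using gc(3) by simp
  then show "d i = 1"
    using chain[of i "h - 1"] pos[of i] i unfolding g_def by auto
qed

text \<open>Reversing the order exchanges the roles of \<open>d\<close> and \<open>e\<close>, so the second half of the chain
  \<open>d\<close> consists of complements of ones.\<close>

lemma coprime_complement_chain:
  fixes d e :: "nat \<Rightarrow> int"
  assumes de: "\<And>i. i < 2 * h \<Longrightarrow> d i * e i = m" and m: "0 < m"
    and pos: "\<And>i. i < 2 * h \<Longrightarrow> 0 < d i"
    and cop: "\<And>i. i < 2 * h \<Longrightarrow> coprime (d i) (e i)"
    and chain: "\<And>i j. i \<le> j \<Longrightarrow> j < 2 * h \<Longrightarrow> d i dvd d j"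
    and prod: "(\<Prod>i<2*h. d i) = (\<Prod>i<2*h. e i)"
    and i: "i < 2 * h"
  shows "d i = (if i < h then 1 else m)"
proof (cases "i < h")
  case True
  then show ?thesis using coprime_complement_chain_first_half[OF de pos cop chain prod] by simp
next
  case False
  let ?r = "\<lambda>i. 2 * h - Suc i"
  have pos': "0 < e j" if "j < 2 * h" for j
    using de[OF that] pos[OF that] m by (metis zero_less_mult_pos)
  have "e (?r (?r i)) = 1"
  proof (rule coprime_complement_chain_first_half[of h "\<lambda>i. e (?r i)" "\<lambda>i. d (?r i)" m])
    fix i j assume ij: "i \<le> j" "j < 2 * h"
    let ?a = "?r j" and ?b = "?r i"
    have "d ?a dvd d ?b" using ij by (intro chain) auto
    then obtain q where q: "d ?b = d ?a * q" by blast
    have "d ?a * e ?a = d ?b * e ?b" using ij de by simp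
    then have "e ?a = q * e ?b" using q pos[of ?a] ij by simp
    then show "e ?b dvd e ?a" by simp
  next
    show "(\<Prod>i<2*h. e (?r i)) = (\<Prod>i<2*h. d (?r i))"
      using prod by (simp add: prod.nat_diff_reindex)
  qed (use de pos' cop i False in \<open>auto simp: mult.commute coprime_commute\<close>)
  then have "e i = 1" using i by simp
  then show ?thesis using de[OF i] False by simp
qed

section \<open>Integral square roots with a contracting homotopy\<close>

lemma has_invariant_factors_two_blocks:
  assumes A: "A \<in> carrier_mat (2 * h) (2 * h)" and m: "0 \<le> m"
    and equiv: "unimod_equiv (2 * h) A (mat_diag (2 * h) (\<lambda>i. if i < h then 1 else m))"
  shows "has_invariant_factors A (replicate h 1 @ replicate h m)" (is "has_invariant_factors A ?ds")
proof -
  have nth: "?ds ! i = (if i < h then 1 else m)" if "i < 2 * h" for i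
    using that by (simp add: nth_append)
  obtain P Q where PQ: "unimodular (2 * h) P" "unimodular (2 * h) Q"
    "P * A * Q = mat_diag (2 * h) (\<lambda>i. if i < h then 1 else m)"
    using equiv unfolding unimod_equiv_def by blast
  have "mat_diag (2 * h) (\<lambda>i. if i < h then 1 else m) = mat_diag (2 * h) (\<lambda>i. ?ds ! i)"
    by (rule eq_matI) (auto simp: mat_diag_def nth)
  then have "\<exists>P \<in> carrier_mat (2 * h) (2 * h). \<exists>Q \<in> carrier_mat (2 * h) (2 * h).
      invertible_mat P \<and> invertible_mat Q \<and> P * A * Q = mat_diag (2 * h) (\<lambda>i. ?ds ! i)"
    using PQ by (metis unimodular_carrier unimodular_invertible_mat)
  moreover have "\<forall>d\<in>set ?ds. 0 \<le> d"
    using m by auto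
  moreover have len: "length ?ds = 2 * h"
    by simp
  moreover have "\<forall>i. Suc i < 2 * h \<longrightarrow> ?ds ! i dvd ?ds ! Suc i"
    by (auto simp: nth)
  ultimately show ?thesis
    using A unfolding has_invariant_factors_def Let_def len by blast
qed

lemma det_unimodular_squared:
  assumes "unimodular n P"
  shows "(det P)\<^sup>2 = 1"
proof -
  obtain P' where "P \<in> carrier_mat n n" "P' \<in> carrier_mat n n" "P * P' = 1\<^sub>m n"
    using assms unfolding unimodular_def by blast
  then have "det P * det P' = 1"
    by (metis det_mult det_one)
  then show ?thesis
    using zmult_eq_1_iff[of "det P" "det P'"] by auto
qed

text \<open>Conjugation by an involution preserves the determinant; the hypothesis is the form in
  which such a conjugation arises from an anticommutation relation.\<close>

lemma det_conj_swap_eq: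
  fixes X Y D :: "int mat"
  assumes "X \<in> carrier_mat n n" "Y \<in> carrier_mat n n" "D \<in> carrier_mat n n"
    and "D * D = 1\<^sub>m n" "X * D = D * Y"
  shows "det X = det Y"
proof -
  have "det D * det D = 1" using assms(3,4) by (metis det_mult det_one)
  moreover have "det X * det D = det D * det Y" using assms by (metis det_mult)
  ultimately show ?thesis
    by (metis mult.commute mult_cancel_left mult_zero_left zero_neq_one)
qed

text \<open>The setting: \<open>A\<close> squares to \<open>N\<close>, so \<open>N - A\<close> and \<open>N + A\<close> multiply to \<open>N\<^sup>2 - N\<close>.  The matrix
  \<open>W\<close> with \<open>W * A + A * W = 1\<close> is a contracting homotopy: reduced modulo \<open>N\<^sup>2 - N\<close>, it makes the
  2-periodic complex with differentials \<open>N - A\<close> and \<open>N + A\<close> split exact.  The involution \<open>D\<close>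
  makes the two differentials conjugate.\<close>

context
  fixes A W D :: "int mat" and n N :: nat
  assumes A: "A \<in> carrier_mat n n" and W: "W \<in> carrier_mat n n" and D: "D \<in> carrier_mat n n"
    and sq: "A * A = int N \<cdot>\<^sub>m 1\<^sub>m n"
    and homotopy: "W * A + A * W = 1\<^sub>m n"
    and D_sq: "D * D = 1\<^sub>m n" and anti: "A * D = - (D * A)"
begin

abbreviation (input) "lower_shift \<equiv> int N \<cdot>\<^sub>m 1\<^sub>m n - A"
abbreviation (input) "upper_shift \<equiv> int N \<cdot>\<^sub>m 1\<^sub>m n + A"

lemma lower_shift_carrier: "lower_shift \<in> carrier_mat n n" and upper_shift_carrier: "upper_shift \<in> carrier_mat n n"
  using A by auto

lemma smult_one_mult: "X \<in> carrier_mat n n \<Longrightarrow> (c \<cdot>\<^sub>m 1\<^sub>m n) * X = c \<cdot>\<^sub>m (X :: int mat)"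
  and mult_smult_one: "X \<in> carrier_mat n n \<Longrightarrow> X * (c \<cdot>\<^sub>m 1\<^sub>m n) = c \<cdot>\<^sub>m (X :: int mat)"
  by (simp_all add: mult_smult_assoc_mat[of _ n n _ n] mult_smult_distrib[of _ n n _ n])

text \<open>Products with \<open>N - A\<close> and \<open>N + A\<close>, written out so that the identities below become
  entrywise linear.\<close>

lemma shift_mult:
  assumes X: "X \<in> carrier_mat n n"
  shows "lower_shift * X = int N \<cdot>\<^sub>m X - A * X" "X * lower_shift = int N \<cdot>\<^sub>m X - X * A"
    "upper_shift * X = int N \<cdot>\<^sub>m X + A * X" "X * upper_shift = int N \<cdot>\<^sub>m X + X * A"
  using A X
  by (simp_all add: minus_mult_distrib_mat[of _ n n _ _ n] mult_minus_distrib_mat[of _ n n _ n]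
      add_mult_distrib_mat[of _ n n _ _ n] mult_add_distrib_mat[of _ n n _ n]
      smult_one_mult mult_smult_one)

lemma lower_upper: "lower_shift * upper_shift = (int N ^ 2 - int N) \<cdot>\<^sub>m 1\<^sub>m n"
  unfolding shift_mult(4)[OF lower_shift_carrier] shift_mult(1)[OF A]
  using A by (intro eq_matI) (auto simp: sq power2_eq_square algebra_simps)

lemma upper_lower: "upper_shift * lower_shift = (int N ^ 2 - int N) \<cdot>\<^sub>m 1\<^sub>m n"
  unfolding shift_mult(2)[OF upper_shift_carrier] shift_mult(3)[OF A]
  using A by (intro eq_matI) (auto simp: sq power2_eq_square algebra_simps)

text \<open>The scalar parts of \<open>W * (N + A)\<close> and \<open>(N - A) * W\<close> cancel, leaving
  \<open>W * A + A * W = 1\<close>.\<close>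

lemma homotopy_exchange: "W * upper_shift = 1\<^sub>m n + lower_shift * W"
  unfolding shift_mult(4)[OF W] shift_mult(1)[OF W]
  unfolding homotopy[symmetric]
  using A W by (intro eq_matI) auto

text \<open>Multiplying the exchange law by \<open>N - A\<close> from the right.  Modulo \<open>N\<^sup>2 - N\<close> it says that
  \<open>- W\<close> is a generalized inverse of \<open>N - A\<close>; this is what forces each invariant factor to be
  coprime to its complementary divisor.\<close>

lemma lower_shift_quasi_regular: "lower_shift + lower_shift * W * lower_shift = (int N ^ 2 - int N) \<cdot>\<^sub>m W"
proof -
  have "(int N ^ 2 - int N) \<cdot>\<^sub>m W = W * (upper_shift * lower_shift)"
    using W by (simp add: upper_lower mult_smult_one)
  also have "\<dots> = W * upper_shift * lower_shift"
    using W lower_shift_carrier upper_shift_carrier by (simp add: assoc_mult_mat[of _ n n _ n _ n])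
  also have "\<dots> = lower_shift + lower_shift * W * lower_shift"
    unfolding homotopy_exchange using W lower_shift_carrier
    by (subst add_mult_distrib_mat[of _ n n _ _ n]) auto
  finally show ?thesis ..
qed

lemma bipartition_intertwines: "upper_shift * D = D * lower_shift"
  unfolding shift_mult(3)[OF D] shift_mult(2)[OF D] anti
  using A D by (intro eq_matI) auto

lemma det_lower_shift_squared: "(det lower_shift)\<^sup>2 = (int N ^ 2 - int N) ^ n"
proof -
  have "det upper_shift = det lower_shift"
    by (rule det_conj_swap_eq[OF upper_shift_carrier lower_shift_carrier D D_sq bipartition_intertwines])
  then have "(det lower_shift)\<^sup>2 = det (lower_shift * upper_shift)"
    using det_mult[OF lower_shift_carrier upper_shift_carrier] by (simp add: power2_eq_square)
  then show ?thesis by (simp add: lower_upper)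
qed

text \<open>In odd dimension, anticommuting with an involution would force \<open>det A = - det A\<close>, but
  \<open>A\<close> is nonsingular.\<close>

lemma even_dimension: "N > 0 \<Longrightarrow> even n"
proof (rule ccontr)
  assume N: "N > 0" and odd: "odd n"
  have "A * D = D * (- 1 \<cdot>\<^sub>m A)"
    unfolding anti using A D by (intro eq_matI) (auto simp: mult_smult_distrib[of _ n n _ n])
  then have "det A = det (- 1 \<cdot>\<^sub>m A)"
    using A by (intro det_conj_swap_eq[OF A _ D D_sq]) auto
  then have "det A = 0"
    using A odd by simp
  moreover have "det A * det A = int N ^ n"
    using det_mult[OF A A] by (simp add: sq)
  ultimately show False using N by simp
qed

text \<open>Let \<open>d\<close> be the diagonal of a Smith normal form of \<open>N - A\<close> and put \<open>m = N\<^sup>2 - N\<close>.  Since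
  \<open>(N - A) * (N + A) = m\<close>, each \<open>d i\<close> has a complement \<open>e i\<close> with \<open>d i * e i = m\<close>.  The
  quasi-regularity of \<open>N - A\<close> makes \<open>d i\<close> and \<open>e i\<close> coprime, and since \<open>N - A\<close> and \<open>N + A\<close> have
  equal determinants, the \<open>d i\<close> and the \<open>e i\<close> have the same product.  The arithmetic of such
  chains then leaves one possibility.\<close>

theorem smith_form_of_shifted_root:
  assumes N: "N \<ge> 2"
  shows "has_invariant_factors lower_shift
    (replicate (n div 2) 1 @ replicate (n div 2) (int N ^ 2 - int N))"
proof -
  define m where "m = int N ^ 2 - int N"
  have m: "m > 0" unfolding m_def using N by (auto simp: power2_eq_square)
  obtain h where n: "n = 2 * h" using even_dimension N by auto
  obtain d where equiv: "unimod_equiv n lower_shift (mat_diag n d)" and d_nonneg: "\<forall>i<n. 0 \<le> d i"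
    and chain: "\<forall>i j. i \<le> j \<longrightarrow> j < n \<longrightarrow> d i dvd d j"
    using smith_normal_form_exists[OF lower_shift_carrier] by (elim exE conjE) (rule that; assumption)
  obtain P Q where P: "unimodular n P" and Q: "unimodular n Q" and PLQ: "P * lower_shift * Q = mat_diag n d"
    using equiv unfolding unimod_equiv_def by blast
  obtain P' Q' where P': "P' \<in> carrier_mat n n" "P' * P = 1\<^sub>m n" "P * P' = 1\<^sub>m n"
    and Q': "Q' \<in> carrier_mat n n" "Q' * Q = 1\<^sub>m n" "Q * Q' = 1\<^sub>m n"
    using P Q unfolding unimodular_def by blast
  note carr = lower_shift_carrier upper_shift_carrier W P[THEN unimodular_carrier] Q[THEN unimodular_carrier] P'(1) Q'(1)
  have assoc: "X * Y * Z = X * (Y * Z)"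
    if "X \<in> carrier_mat n n" "Y \<in> carrier_mat n n" "Z \<in> carrier_mat n n" for X Y Z :: "int mat"
    using assoc_mult_mat[OF that] .
  note one = left_mult_one_mat[of _ n n] right_mult_one_mat[of _ n n]
  define M where "M = lower_shift"
  define M' where "M' = upper_shift"
  note carr = carr[folded M_def M'_def]
  have mc: "X * Y \<in> carrier_mat n n" if "X \<in> carrier_mat n n" "Y \<in> carrier_mat n n" for X Y :: "int mat"
    using mult_carrier_mat[OF that] .
  have PMQ: "P * M * Q = mat_diag n d" using PLQ M_def by simp
  have "mat_diag n d * (Q' * M' * P') = P * M * (Q * Q') * M' * P'"
    unfolding PMQ[symmetric] by (simp add: assoc mc carr one)
  also have "\<dots> = P * (M * M') * P'"
    using Q' by (simp add: assoc mc carr one)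
  also have "\<dots> = m \<cdot>\<^sub>m 1\<^sub>m n"
    using P' carr unfolding M_def M'_def lower_upper m_def[symmetric]
    by (simp add: mult_smult_one mult_smult_assoc_mat[of _ n n _ n])
  finally have cofactor: "mat_diag n d * (Q' * M' * P') = m \<cdot>\<^sub>m 1\<^sub>m n" .
  define e where "e i = (Q' * M' * P') $$ (i, i)" for i
  have de: "d i * e i = m" if "i < n" for i
  proof -
    have "(mat_diag n d * (Q' * M' * P')) $$ (i, i) = d i * e i"
      using that by (subst mat_diag_mult_left[of _ n n]) (simp_all add: mc carr e_def)
    then show ?thesis unfolding cofactor using that by simp
  qed
  have pos: "0 < d i" if "i < n" for i
    using de[OF that] d_nonneg that m by (cases "d i = 0") (auto simp: order_less_le)
  have "P * (M * W * M) * Q = P * M * (Q * Q') * W * (P' * P) * M * Q"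
    using P' Q' by (simp add: assoc mc carr one)
  also have "\<dots> = mat_diag n d * (Q' * W * P') * mat_diag n d"
    unfolding PMQ[symmetric] by (simp add: assoc mc carr one)
  finally have sandwich: "P * (M * W * M) * Q = mat_diag n d * (Q' * W * P') * mat_diag n d" .
  have "m \<cdot>\<^sub>m (P * W * Q) = P * (M + M * W * M) * Q"
    unfolding M_def lower_shift_quasi_regular m_def[symmetric]
    using carr by (simp add: mult_smult_distrib[of _ n n _ n] mult_smult_assoc_mat[of _ n n _ n] mc)
  also have "\<dots> = mat_diag n d + mat_diag n d * (Q' * W * P') * mat_diag n d"
    unfolding sandwich[symmetric]
    by (subst PMQ[symmetric], subst mult_add_distrib_mat[of _ n n _ n])
      (simp_all add: add_mult_distrib_mat[of _ n n _ _ n] mc carr)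
  finally have regular:
    "m \<cdot>\<^sub>m (P * W * Q) = mat_diag n d + mat_diag n d * (Q' * W * P') * mat_diag n d" .
  \<comment> \<open>The diagonal entries of the quasi-regularity relation, in Smith coordinates, are
    \<open>m * y = d i + d i * z * d i\<close>; cancelling \<open>d i\<close> gives a Bezout identity.\<close>
  have cop: "coprime (d i) (e i)" if i: "i < n" for i
  proof -
    define y z where "y = (P * W * Q) $$ (i, i)" and "z = (Q' * W * P') $$ (i, i)"
    have sand: "mat_diag n d * (Q' * W * P') * mat_diag n d
        = Matrix.mat n n (\<lambda>(i, j). d i * (Q' * W * P') $$ (i, j) * d j)"
      by (subst mat_diag_mult_left[of _ n n], simp add: mc carr, subst mat_diag_mult_right[of _ n n])
        auto
    have "(m \<cdot>\<^sub>m (P * W * Q)) $$ (i, i) = m * y"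
      using i mc[OF mc[OF carr(4,3)] carr(5)] unfolding y_def by (subst index_smult_mat) auto
    moreover have "(mat_diag n d + mat_diag n d * (Q' * W * P') * mat_diag n d) $$ (i, i)
        = d i + d i * z * d i"
      unfolding sand using i by (simp add: mat_diag_def z_def)
    ultimately have "d i + d i * z * d i = m * y"
      unfolding regular by simp
    then have "d i * (1 + d i * z) = d i * (e i * y)"
      using de[OF i] by (simp add: algebra_simps)
    then have "1 = e i * y - d i * z"
      using pos[OF i] by simp
    then show ?thesis
      by (metis coprimeI dvd_diff dvd_mult2)
  qed
  have "(\<Prod>i<n. d i)\<^sup>2 = (det P)\<^sup>2 * (det lower_shift)\<^sup>2 * (det Q)\<^sup>2"
  proof -
    have "(\<Prod>i<n. d i) = det (mat_diag n d)"
      by (subst det_upper_triangular[of _ n])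
        (auto simp: upper_triangular_def mat_diag_def prod_list_diag_prod lessThan_atLeast0)
    also have "\<dots> = det P * det lower_shift * det Q"
      unfolding PLQ[symmetric] using carr(1,4,5) mc[OF carr(4,1)] unfolding M_def
      by (simp add: det_mult[of _ n])
    finally show ?thesis by (simp add: power_mult_distrib)
  qed
  also have "\<dots> = m ^ n"
    using P Q by (simp add: det_unimodular_squared det_lower_shift_squared m_def)
  also have "\<dots> = (\<Prod>i<n. d i * e i)"
    using de by simp
  finally have "(\<Prod>i<n. d i) * (\<Prod>i<n. d i) = (\<Prod>i<n. d i) * (\<Prod>i<n. e i)"
    by (simp add: power2_eq_square prod.distrib)
  moreover have "(\<Prod>i<n. d i) \<noteq> 0"
    using pos by (auto simp: order_less_le)
  ultimately have prod_eq: "(\<Prod>i<n. d i) = (\<Prod>i<n. e i)"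
    by simp
  have "d i = (if i < h then 1 else m)" if "i < n" for i
    using de m pos cop chain prod_eq that unfolding n
    by (intro coprime_complement_chain) auto
  then have "mat_diag n d = mat_diag n (\<lambda>i. if i < h then 1 else m)"
    by (intro eq_matI) (auto simp: mat_diag_def)
  with equiv have "has_invariant_factors lower_shift (replicate h 1 @ replicate h m)"
    using lower_shift_carrier m unfolding n by (intro has_invariant_factors_two_blocks) auto
  then show ?thesis unfolding n m_def by simp
qed

end

section \<open>Anticommuting signed involutions\<close>

text \<open>Each color contributes a signed permutation of the vertices; the axioms say that these
  signed permutations are involutions and anticommute pairwise, that is, that they represent the
  generators of a Clifford algebra.\<close>

locale signed_involutions =
  fixes V :: "'v set" and \<nu> :: "'n::finite \<Rightarrow> 'v \<Rightarrow> 'v" and s :: "'n \<Rightarrow> 'v \<Rightarrow> int"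
  assumes finite_vertices: "finite V"
    and nbr_closed: "v \<in> V \<Longrightarrow> \<nu> i v \<in> V"
    and nbr_nbr: "v \<in> V \<Longrightarrow> \<nu> i (\<nu> i v) = v"
    and sign_sign: "v \<in> V \<Longrightarrow> s i v * s i (\<nu> i v) = 1"
    and nbr_commute: "v \<in> V \<Longrightarrow> i \<noteq> j \<Longrightarrow> \<nu> j (\<nu> i v) = \<nu> i (\<nu> j v)"
    and sign_anticommute:
      "v \<in> V \<Longrightarrow> i \<noteq> j \<Longrightarrow> s i v * s j (\<nu> i v) = - (s j v * s i (\<nu> j v))"
begin

definition step :: "'n set \<Rightarrow> ('v \<Rightarrow> int) \<Rightarrow> 'v \<Rightarrow> int" where
  "step S f v = (\<Sum>i\<in>S. s i v * f (\<nu> i v))"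

lemma step_linear: "step S (\<lambda>w. a * f w + b * g w) v = a * step S f v + b * step S g v"
  unfolding step_def by (simp add: sum_distrib_left sum.distrib algebra_simps)

text \<open>The mixed terms of two distinct colors cancel in pairs, and each common color contributes
  its square twice.\<close>

lemma step_anticommute:
  assumes v: "v \<in> V"
  shows "step S (step T f) v + step T (step S f) v = 2 * int (card (S \<inter> T)) * f v"
proof -
  define t where "t i j = s i v * s j (\<nu> i v) * f (\<nu> j (\<nu> i v))" for i j
  have t_sum: "t i j + t j i = (if i = j then 2 * f v else 0)" for i j
  proof (cases "i = j")
    case True
    then show ?thesis
      unfolding t_def by (simp add: nbr_nbr[OF v] sign_sign[OF v])
  next
    case False
    then show ?thesis
      unfolding t_def nbr_commute[OF v False] sign_anticommute[OF v False] by simp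
  qed
  have "step S (step T f) v + step T (step S f) v = (\<Sum>i\<in>S. \<Sum>j\<in>T. t i j) + (\<Sum>j\<in>T. \<Sum>i\<in>S. t j i)"
    unfolding step_def t_def by (simp add: sum_distrib_left mult.assoc)
  also have "(\<Sum>j\<in>T. \<Sum>i\<in>S. t j i) = (\<Sum>i\<in>S. \<Sum>j\<in>T. t j i)"
    by (rule sum.swap)
  also have "(\<Sum>i\<in>S. \<Sum>j\<in>T. t i j) + \<dots> = (\<Sum>i\<in>S. \<Sum>j\<in>T. if i = j then 2 * f v else 0)"
    by (simp add: sum.distrib [symmetric] t_sum)
  also have "\<dots> = (\<Sum>i\<in>S. if i \<in> T then 2 * f v else 0)"
    by simp
  also have "\<dots> = (\<Sum>i\<in>S \<inter> T. 2 * f v)"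
    by (rule sum.inter_restrict [symmetric]) simp
  finally show ?thesis by simp
qed

corollary step_squared: "v \<in> V \<Longrightarrow> step S (step S f) v = int (card S) * f v"
  using step_anticommute[of v S S f] by simp

text \<open>Anticommuting the single color \<open>c\<close> with the sum of all colors gives \<open>2\<close>, and anticommuting
  the graded part \<open>g * step U\<close> with it gives the number of colors in \<open>U\<close>, provided that \<open>g\<close> flips
  along \<open>U\<close>.  If this number is \<open>2 * t + 1\<close>, the combination gives \<open>1\<close>.\<close>

definition homotopy ::
    "'n set \<Rightarrow> 'n \<Rightarrow> int \<Rightarrow> ('v \<Rightarrow> int) \<Rightarrow> ('v \<Rightarrow> int) \<Rightarrow> 'v \<Rightarrow> int" where
  "homotopy U c t g f v = g v * step U f v - t * step {c} f v"

text \<open>The relation \<open>g_nbr\<close> is the one that a \<open>0\<close>-\<open>1\<close> valued grading satisfies when it flips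
  exactly along the edges with color in \<open>U\<close>.\<close>

context
  fixes U :: "'n set" and t :: int and g :: "'v \<Rightarrow> int"
  assumes card_U: "int (card U) = 2 * t + 1"
    and g_nbr: "\<And>v i. v \<in> V \<Longrightarrow> g (\<nu> i v) = (if i \<in> U then 1 - g v else g v)"
begin

text \<open>The colors in \<open>U\<close> flip the grading, so commuting \<open>g\<close> past the sum of all colors leaves a
  multiple of the sum over \<open>U\<close>, whose square is the scalar \<open>card U\<close>.\<close>

lemma step_graded:
  assumes v: "v \<in> V"
  shows "step UNIV (\<lambda>w. g w * f w) v = g v * step UNIV f v + (1 - 2 * g v) * step U f v"
proof -
  have "step UNIV (\<lambda>w. g w * f w) v
      = (\<Sum>i\<in>UNIV. g v * (s i v * f (\<nu> i v)) + (if i \<in> U then (1 - 2 * g v) * (s i v * f (\<nu> i v)) else 0))"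
    unfolding step_def by (intro sum.cong) (auto simp: g_nbr[OF v] algebra_simps)
  also have "\<dots> = g v * step UNIV f v + (1 - 2 * g v) * step U f v"
    unfolding step_def
    by (simp add: sum.distrib sum_distrib_left sum.If_cases)
  finally show ?thesis .
qed

lemma homotopy_contracts:
  assumes v: "v \<in> V"
  shows "homotopy U c t g (step UNIV f) v + step UNIV (homotopy U c t g f) v = f v"
proof -
  have "step UNIV (homotopy U c t g f) v
      = step UNIV (\<lambda>w. 1 * (g w * step U f w) + (- t) * step {c} f w) v"
    by (simp add: homotopy_def [abs_def])
  also have "\<dots> = step UNIV (\<lambda>w. g w * step U f w) v - t * step UNIV (step {c} f) v"
    unfolding step_linear by simp
  also have "step UNIV (\<lambda>w. g w * step U f w) v
      = g v * step UNIV (step U f) v + (1 - 2 * g v) * (int (card U) * f v)"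
    using v by (simp add: step_graded step_squared)
  finally have "homotopy U c t g (step UNIV f) v + step UNIV (homotopy U c t g f) v
      = g v * (step U (step UNIV f) v + step UNIV (step U f) v)
        - t * (step {c} (step UNIV f) v + step UNIV (step {c} f) v)
        + (1 - 2 * g v) * (int (card U) * f v)"
    unfolding homotopy_def by (simp add: algebra_simps)
  also have "\<dots> = g v * (2 * int (card U) * f v) - t * (2 * f v) + (1 - 2 * g v) * (int (card U) * f v)"
    by (simp add: step_anticommute[OF v])
  also have "\<dots> = f v"
    unfolding card_U by (simp add: algebra_simps)
  finally show ?thesis .
qed

end

end

section \<open>Matrices of operators on functions\<close>

definition delta :: "'v \<Rightarrow> 'v \<Rightarrow> int" where
  "delta w v = (if v = w then 1 else 0)"

definition op_mat :: "'v list \<Rightarrow> (('v \<Rightarrow> int) \<Rightarrow> 'v \<Rightarrow> int) \<Rightarrow> int mat" where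
  "op_mat vs T = Matrix.mat (length vs) (length vs) (\<lambda>(p, q). T (delta (vs ! q)) (vs ! p))"

text \<open>On functions restricted to \<open>V\<close>, such an operator is determined by its matrix; this is the
  linearity needed for composition to become matrix multiplication.\<close>

definition kernel_op :: "'v set \<Rightarrow> (('v \<Rightarrow> int) \<Rightarrow> 'v \<Rightarrow> int) \<Rightarrow> bool" where
  "kernel_op V T \<longleftrightarrow> (\<forall>f. \<forall>v\<in>V. T f v = (\<Sum>w\<in>V. T (delta w) v * f w))"

lemma op_mat_carrier [simp]: "op_mat vs T \<in> carrier_mat (length vs) (length vs)"
  by (simp add: op_mat_def)

lemma op_mat_index [simp]:
  "p < length vs \<Longrightarrow> q < length vs \<Longrightarrow> op_mat vs T $$ (p, q) = T (delta (vs ! q)) (vs ! p)"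
  "dim_row (op_mat vs T) = length vs" "dim_col (op_mat vs T) = length vs"
  by (simp_all add: op_mat_def)

lemma op_mat_mult:
  assumes "distinct vs" "kernel_op (set vs) T"
  shows "op_mat vs T * op_mat vs S = op_mat vs (\<lambda>f. T (S f))"
proof (rule eq_matI)
  fix p q assume "p < dim_row (op_mat vs (\<lambda>f. T (S f)))" "q < dim_col (op_mat vs (\<lambda>f. T (S f)))"
  then have pq: "p < length vs" "q < length vs" by simp_all
  have "(op_mat vs T * op_mat vs S) $$ (p, q)
      = (\<Sum>r<length vs. T (delta (vs ! r)) (vs ! p) * S (delta (vs ! q)) (vs ! r))"
    using pq by (simp add: scalar_prod_def lessThan_atLeast0)
  also have "\<dots> = (\<Sum>w\<in>set vs. T (delta w) (vs ! p) * S (delta (vs ! q)) w)"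
    using bij_betw_nth[OF assms(1), of "{..<length vs}" "set vs"]
    by (intro sum.reindex_bij_betw) auto
  also have "\<dots> = T (S (delta (vs ! q))) (vs ! p)"
    using assms(2) pq unfolding kernel_op_def by (metis nth_mem)
  finally show "(op_mat vs T * op_mat vs S) $$ (p, q) = op_mat vs (\<lambda>f. T (S f)) $$ (p, q)"
    using pq by simp
qed simp_all

context signed_involutions
begin

lemma kernel_op_step: "kernel_op V (step S)"
  unfolding kernel_op_def
proof (intro allI ballI)
  fix f v assume v: "v \<in> V"
  have "(\<Sum>w\<in>V. step S (delta w) v * f w) = (\<Sum>w\<in>V. \<Sum>i\<in>S. if w = \<nu> i v then s i v * f (\<nu> i v) else 0)"
    unfolding step_def delta_def sum_distrib_right by (intro sum.cong) auto
  also have "\<dots> = (\<Sum>i\<in>S. \<Sum>w\<in>V. if w = \<nu> i v then s i v * f (\<nu> i v) else 0)"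
    by (rule sum.swap)
  also have "\<dots> = step S f v"
    unfolding step_def using finite_vertices nbr_closed[OF v] by (intro sum.cong) auto
  finally show "step S f v = (\<Sum>w\<in>V. step S (delta w) v * f w)" ..
qed

lemma kernel_op_homotopy: "kernel_op V (homotopy U c t g)"
  unfolding kernel_op_def
proof (intro allI ballI)
  fix f v assume v: "v \<in> V"
  have "step S f v = (\<Sum>w\<in>V. step S (delta w) v * f w)" for S
    using kernel_op_step v unfolding kernel_op_def by blast
  from this[of U] this[of "{c}"]
  show "homotopy U c t g f v = (\<Sum>w\<in>V. homotopy U c t g (delta w) v * f w)"
    unfolding homotopy_def
    by (simp add: sum_distrib_left left_diff_distrib sum_subtractf mult.assoc)
qed

text \<open>The sign \<open>b\<close> of a bipartition anticommutes with every color and plays the role of the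
  conjugating involution.  The color in the homotopy is arbitrary.\<close>

theorem step_smith_form:
  fixes b g :: "'v \<Rightarrow> int"
  assumes vs: "distinct vs" "set vs = V"
    and N: "CARD('n) \<ge> 2"
    and U: "odd (card U)"
    and g: "\<And>v i. v \<in> V \<Longrightarrow> g (\<nu> i v) = (if i \<in> U then 1 - g v else g v)"
    and b: "\<And>v. v \<in> V \<Longrightarrow> b v \<in> {-1, 1}" "\<And>v i. v \<in> V \<Longrightarrow> b (\<nu> i v) = - b v"
  shows "has_invariant_factors (int CARD('n) \<cdot>\<^sub>m 1\<^sub>m (length vs) - op_mat vs (step UNIV))
    (replicate (length vs div 2) 1 @ replicate (length vs div 2) (int CARD('n) ^ 2 - int CARD('n)))"
proof -
  define t where "t = int (card U div 2)"
  have t: "int (card U) = 2 * t + 1"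
    using U unfolding t_def by presburger
  obtain c :: 'n where True by simp
  define W where "W = op_mat vs (homotopy U c t g)"
  define A where "A = op_mat vs (step UNIV)"
  define D where "D = op_mat vs (\<lambda>f v. b v * f v)"
  have in_V: "vs ! p \<in> V" if "p < length vs" for p
    using that vs by auto
  have delta: "delta (vs ! q) (vs ! p) = (if p = q then 1 else 0)" if "p < length vs" "q < length vs" for p q
    using that vs(1) by (simp add: delta_def nth_eq_iff_index_eq)
  have D_kernel: "kernel_op V (\<lambda>f v. b v * f v)"
    unfolding kernel_op_def using finite_vertices
    by (auto simp: delta_def if_distrib[of "\<lambda>x. _ * x"] if_distrib[of "\<lambda>x. x * _"] cong: if_cong)
  note mult = op_mat_mult[OF vs(1), unfolded vs(2)]
  show ?thesis
    unfolding A_def[symmetric]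
  proof (rule smith_form_of_shifted_root[of A "length vs" W D "CARD('n)"])
    show "A * A = int CARD('n) \<cdot>\<^sub>m 1\<^sub>m (length vs)"
      unfolding A_def mult[OF kernel_op_step]
      by (rule eq_matI) (simp_all add: step_squared in_V delta)
    show "W * A + A * W = 1\<^sub>m (length vs)"
      unfolding A_def W_def mult[OF kernel_op_step] mult[OF kernel_op_homotopy]
      by (rule eq_matI) (simp_all add: homotopy_contracts[OF t g] in_V delta)
    show "D * D = 1\<^sub>m (length vs)"
      unfolding D_def mult[OF D_kernel]
      by (rule eq_matI) (use b(1) in_V in \<open>fastforce simp: delta\<close>)+
    show "A * D = - (D * A)"
      unfolding A_def D_def mult[OF D_kernel] mult[OF kernel_op_step]
      by (rule eq_matI) (simp_all add: step_def b(2) in_V sum_distrib_left mult.left_commute sum_negf)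
  qed (simp_all add: A_def W_def D_def N)
qed

end

section \<open>The signed involutions of an Adinkra\<close>

text \<open>A 4-cycle can be rotated and reflected so that it starts with a given oriented edge.\<close>

lemma four_cycle_through_edge:
  assumes "four_cycle Z" "{v, w} \<in> Z"
  obtains c d where "distinct [v, w, c, d]" "Z = {{v, w}, {w, c}, {c, d}, {d, v}}"
proof -
  note found = that
  obtain a b c d where *: "distinct [a, b, c, d]" "Z = {{a, b}, {b, c}, {c, d}, {d, a}}"
    using assms(1) unfolding four_cycle_def by blast
  have rotated: thesis if "{v, w} = {a', b'}" "distinct [a', b', c', d']"
    "Z = {{a', b'}, {b', c'}, {c', d'}, {d', a'}}" for a' b' c' d'
  proof (cases "v = a' \<and> w = b'")
    case True
    with that show thesis by (intro found[of c' d']) auto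
  next
    case False
    with that(1) have "v = b'" "w = a'" by (auto simp: doubleton_eq_iff)
    with that(2,3) show thesis
      by (intro found[of d' c']) (auto simp: insert_commute)
  qed
  have "{v, w} = {a, b} \<or> {v, w} = {b, c} \<or> {v, w} = {c, d} \<or> {v, w} = {d, a}"
    using assms(2) *(2) by blast
  then show thesis
    using rotated[of a b c d] rotated[of b c d a] rotated[of c d a b] rotated[of d a b c] *
    by (auto simp: insert_commute)
qed

lemma prod_of_signs:
  fixes \<mu> :: "'a \<Rightarrow> int"
  assumes "finite Z" "\<And>e. e \<in> Z \<Longrightarrow> \<mu> e \<in> {-1, 1}"
  shows "(\<Prod>e\<in>Z. \<mu> e) = (-1) ^ card {e \<in> Z. \<mu> e = -1}"
proof -
  have "(\<Prod>e\<in>Z. \<mu> e) = (\<Prod>e\<in>Z. if \<mu> e = -1 then -1 else 1)"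
    using assms(2) by (intro prod.cong) auto
  also have "\<dots> = (-1) ^ card (Z \<inter> {e. \<mu> e = -1})"
    using assms(1) by (simp add: prod.If_cases)
  also have "Z \<inter> {e. \<mu> e = -1} = {e \<in> Z. \<mu> e = -1}"
    by blast
  finally show ?thesis .
qed

context adinkra
begin

definition nbr :: "'n \<Rightarrow> 'v \<Rightarrow> 'v" where
  "nbr i v = (THE w. {v, w} \<in> E \<and> color {v, w} = i)"

definition sign :: "'n \<Rightarrow> 'v \<Rightarrow> int" where
  "sign i v = \<mu> {v, nbr i v}"

lemma edge_vertices: "{v, w} \<in> E \<Longrightarrow> v \<in> V \<and> w \<in> V \<and> v \<noteq> w"
  using edges[of "{v, w}"] by (auto simp: doubleton_eq_iff)

lemma ex1_nbr:
  assumes v: "v \<in> V"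
  shows "\<exists>!w. {v, w} \<in> E \<and> color {v, w} = i"
proof -
  obtain e where e: "e \<in> E" "v \<in> e" "color e = i"
    and uniq: "\<And>e'. e' \<in> E \<Longrightarrow> v \<in> e' \<Longrightarrow> color e' = i \<Longrightarrow> e' = e"
    using one_edge_per_color[OF v, of i] by blast
  obtain w where w: "e = {v, w}"
    using edges[OF e(1)] e(2) by auto
  show ?thesis
  proof (rule ex1I[of _ w])
    fix w' assume "{v, w'} \<in> E \<and> color {v, w'} = i"
    then have "{v, w'} = {v, w}" using uniq[of "{v, w'}"] w by simp
    then show "w' = w" by (auto simp: doubleton_eq_iff)
  qed (use e w in simp)
qed

lemma nbr_edge: "v \<in> V \<Longrightarrow> {v, nbr i v} \<in> E \<and> color {v, nbr i v} = i"
  unfolding nbr_def using ex1_nbr by (rule theI')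

lemma nbr_eqI: "{v, w} \<in> E \<Longrightarrow> color {v, w} = i \<Longrightarrow> nbr i v = w"
  using ex1_nbr[of v i] nbr_edge[of v i] edge_vertices by blast

lemma nbr_in_V: "v \<in> V \<Longrightarrow> nbr i v \<in> V"
  using nbr_edge edge_vertices by blast

lemma nbr_involution: "v \<in> V \<Longrightarrow> nbr i (nbr i v) = v"
  using nbr_edge[of v i] by (intro nbr_eqI) (simp_all add: insert_commute)

lemma sign_values: "v \<in> V \<Longrightarrow> sign i v \<in> {-1, 1}"
  unfolding sign_def using nbr_edge signature by blast

lemma sign_nbr: "v \<in> V \<Longrightarrow> sign i (nbr i v) = sign i v"
  by (simp add: sign_def nbr_involution insert_commute)

text \<open>Starting at \<open>v\<close> with color \<open>i\<close>, the bicolor cycle through \<open>v\<close> must alternate the two colors,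
  since a vertex has only one edge of each color.  So it closes up after the steps \<open>i, j, i, j\<close>,
  which is the commutation.  An odd number of dashed edges means that its four signs multiply to
  \<open>-1\<close>, which is the anticommutation of signs.\<close>

lemma bicolor_square:
  assumes v: "v \<in> V" and ij: "i \<noteq> j"
  shows "nbr j (nbr i v) = nbr i (nbr j v)" (is ?commute)
    and "sign i v * sign j (nbr i v) = - (sign j v * sign i (nbr j v))" (is ?anticommute)
proof -
  define w where "w = nbr i v"
  have vw: "{v, w} \<in> E" "color {v, w} = i"
    using nbr_edge[OF v] w_def by auto
  obtain F where F: "\<forall>Z\<in>F. four_cycle Z" "\<Union>F = bicolor_edges E color i j"
    using bicolor_cycles[OF ij] unfolding disjoint_union_of_four_cycles_def by blast
  have "{v, w} \<in> bicolor_edges E color i j"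
    using vw by (simp add: bicolor_edges_def)
  then obtain Z where Z: "four_cycle Z" "{v, w} \<in> Z" "Z \<subseteq> bicolor_edges E color i j"
    using F by blast
  obtain c d where dist: "distinct [v, w, c, d]" and Z_eq: "Z = {{v, w}, {w, c}, {c, d}, {d, v}}"
    using four_cycle_through_edge[OF Z(1,2)] by blast
  have in_E: "{w, c} \<in> E" "{c, d} \<in> E" "{d, v} \<in> E"
    and col: "color {w, c} \<in> {i, j}" "color {c, d} \<in> {i, j}" "color {d, v} \<in> {i, j}"
    using Z(3) unfolding Z_eq bicolor_edges_def by auto
  have "color {w, c} \<noteq> i"
    using nbr_eqI[of w c i] nbr_eqI[of w v i] vw in_E dist by (auto simp: insert_commute)
  then have wc: "nbr j w = c"
    using col(1) in_E by (intro nbr_eqI) auto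
  have "color {c, d} \<noteq> j"
    using nbr_eqI[of c d j] nbr_eqI[of c w j] in_E col(1) dist \<open>color {w, c} \<noteq> i\<close>
    by (auto simp: insert_commute)
  then have dc: "nbr i d = c"
    using col(2) in_E by (intro nbr_eqI) (auto simp: insert_commute)
  have "color {d, v} \<noteq> i"
    using nbr_eqI[of v d i] nbr_eqI[of v w i] vw in_E dist by (auto simp: insert_commute)
  then have vd: "nbr j v = d"
    using col(3) in_E by (intro nbr_eqI) (auto simp: insert_commute)
  show ?commute
    using wc dc vd w_def by simp
  have "(\<Prod>e\<in>Z. \<mu> e) = -1"
    using odd_dashed[OF ij Z(1,3)] Z(3) signature
    by (subst prod_of_signs) (auto simp: Z_eq bicolor_edges_def)
  moreover have "(\<Prod>e\<in>Z. \<mu> e) = \<mu> {v, w} * (\<mu> {w, c} * (\<mu> {c, d} * \<mu> {d, v}))"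
    unfolding Z_eq using dist by (auto simp: doubleton_eq_iff)
  moreover have "sign i v = \<mu> {v, w}" "sign j (nbr i v) = \<mu> {w, c}"
    "sign j v = \<mu> {d, v}" "sign i (nbr j v) = \<mu> {c, d}"
    using wc dc vd w_def by (auto simp: sign_def insert_commute)
  moreover have "\<mu> {v, w} \<in> {-1, 1}" "\<mu> {w, c} \<in> {-1, 1}" "\<mu> {c, d} \<in> {-1, 1}" "\<mu> {d, v} \<in> {-1, 1}"
    using signature vw in_E by blast+
  ultimately show ?anticommute by auto
qed

sublocale signed_involutions V nbr sign
proof
  show "sign i v * sign i (nbr i v) = 1" if "v \<in> V" for i v
    using sign_values[OF that, of i] sign_nbr[OF that, of i] by auto
qed (fact finite_V nbr_in_V nbr_involution bicolor_square)+

lemma op_mat_step: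
  assumes "set vs = V"
  shows "op_mat vs (step UNIV) = signed_adjacency E \<mu> vs"
proof (rule eq_matI)
  fix p q
  assume "p < dim_row (signed_adjacency E \<mu> vs)" "q < dim_col (signed_adjacency E \<mu> vs)"
  then have pq: "p < length vs" "q < length vs" by (simp_all add: signed_adjacency_def)
  define v w where "v = vs ! p" and "w = vs ! q"
  have v: "v \<in> V" using pq assms by (auto simp: v_def)
  have "step UNIV (delta w) v = (\<Sum>i\<in>UNIV. if nbr i v = w then \<mu> {v, w} else 0)"
    unfolding step_def delta_def sign_def by (intro sum.cong) auto
  also have "\<dots> = (if {v, w} \<in> E then \<mu> {v, w} else 0)"
  proof (cases "{v, w} \<in> E")
    case True
    have "nbr i v = w \<longleftrightarrow> i = color {v, w}" for i
      using nbr_edge[OF v, of i] nbr_eqI[OF True, of i] by auto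
    then show ?thesis using True by simp
  next
    case False
    then have "nbr i v \<noteq> w" for i
      using nbr_edge[OF v, of i] by auto
    then show ?thesis using False by simp
  qed
  finally show "op_mat vs (step UNIV) $$ (p, q) = signed_adjacency E \<mu> vs $$ (p, q)"
    using pq by (simp add: signed_adjacency_def v_def w_def)
qed (simp_all add: signed_adjacency_def)

lemma bipartite_sign:
  "\<exists>b :: 'v \<Rightarrow> int. (\<forall>v. b v \<in> {-1, 1}) \<and> (\<forall>v\<in>V. \<forall>i. b (nbr i v) = - b v)"
proof -
  obtain X Y where XY: "X \<union> Y = V" "X \<inter> Y = {}" "\<forall>e\<in>E. \<exists>x\<in>X. \<exists>y\<in>Y. e = {x, y}"
    using bipartite unfolding bipartite_def by blast
  let ?b = "\<lambda>v. if v \<in> X then 1 else - 1 :: int"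
  have "?b (nbr i v) = - ?b v" if v: "v \<in> V" for i v
  proof -
    obtain x y where "x \<in> X" "y \<in> Y" "{v, nbr i v} = {x, y}"
      using XY(3) nbr_edge[OF v, of i] by blast
    then show ?thesis using XY(2) by (auto simp: doubleton_eq_iff)
  qed
  then show ?thesis by (intro exI[of _ ?b]) auto
qed

end

section \<open>Odd dual words and gradings\<close>

text \<open>A basis of \<open>C\<close> together with \<open>x\<close> is independent, so the values on it can be prescribed for
  a linear endomorphism, any coordinate of which is such a functional.\<close>

lemma separating_functional:
  fixes C :: "('a :: field ^ 'n :: finite) set"
  assumes C: "vec.subspace C" and x: "x \<notin> C"
  obtains \<phi> :: "'a ^ 'n \<Rightarrow> 'a" where "\<And>y z. \<phi> (y + z) = \<phi> y + \<phi> z" "\<forall>c\<in>C. \<phi> c = 0" "\<phi> x = 1"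
proof -
  obtain B where B: "B \<subseteq> C" "vec.independent B" "C \<subseteq> vec.span B"
    by (rule vec.maximal_independent_subset[of C])
  have span: "vec.span B = C"
    using B C by (intro subset_antisym vec.span_minimal)
  then have ind: "vec.independent (insert x B)"
    using B(2) x by (intro vec.independent_insertI) auto
  have "\<exists>g :: 'a ^ 'n \<Rightarrow> 'a ^ 'n. Vector_Spaces.linear (*s) (*s) g \<and>
    (\<forall>y\<in>insert x B. g y = (if y = x then (\<chi> i. 1) else 0))"
    by (rule vec.linear_independent_extend[OF ind])
  then obtain g :: "'a ^ 'n \<Rightarrow> 'a ^ 'n" where g: "Vector_Spaces.linear (*s) (*s) g"
    "\<forall>y\<in>insert x B. g y = (if y = x then (\<chi> i. 1) else 0)"
    by (elim exE conjE)
  interpret g: Vector_Spaces.linear "(*s)" "(*s)" g by fact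
  have "x \<notin> B" using B(1) x by auto
  then have B0: "g y = 0" if "y \<in> B" for y
    using that g(2) by auto
  have *: "g c = 0" if "c \<in> C" for c
    using g.eq_0_on_span[of B c] B0 that unfolding span by blast
  obtain k :: 'n where True by simp
  show thesis
    using g(2) * by (intro that[of "\<lambda>y. g y $ k"]) (simp_all add: g.add)
qed

text \<open>The coordinates of a functional form a dual word; its value at the all-ones vector is the
  parity of the weight of that word.\<close>

lemma odd_support_of_functional:
  fixes \<phi> :: "bit ^ 'n :: finite \<Rightarrow> bit"
  assumes add: "\<And>x y. \<phi> (x + y) = \<phi> x + \<phi> y" and one: "\<phi> (\<chi> i. 1) = 1"
  shows "odd (card {i. \<phi> (axis i 1) = 1})" (is "odd (card ?U)")
proof
  have zero: "\<phi> 0 = 0" using add[of 0 0] by simp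
  have sum: "\<phi> (\<Sum>i\<in>S. f i) = (\<Sum>i\<in>S. \<phi> (f i))" if "finite S" for S :: "'n set" and f
    using that by (induction S) (simp_all add: zero add)
  have "(\<chi> i. 1) = (\<Sum>i\<in>UNIV. axis i 1 :: bit ^ 'n)"
    by (simp add: Finite_Cartesian_Product.vec_eq_iff axis_def)
  then have "1 = (\<Sum>i\<in>UNIV. \<phi> (axis i 1))"
    using one sum by (metis finite)
  also have "\<dots> = (\<Sum>i\<in>UNIV. if i \<in> ?U then 1 else 0)"
    by (intro sum.cong) auto
  also have "\<dots> = of_nat (card ?U)"
    by (simp add: sum.If_cases)
  finally have *: "of_nat (card ?U) = (1 :: bit)" ..
  assume "even (card ?U)"
  then obtain k where "card ?U = 2 * k" by blast
  with * show False by simp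
qed

lemma cube_adj_iff: "cube_adj i x y \<longleftrightarrow> y = x + axis i 1"
proof -
  have "x $ k \<noteq> y $ k \<longleftrightarrow> y $ k = x $ k + 1" "x $ k = y $ k \<longleftrightarrow> y $ k = x $ k + 0" for k
    by (cases "x $ k"; cases "y $ k"; simp)+
  then show ?thesis
    unfolding cube_adj_def Finite_Cartesian_Product.vec_eq_iff axis_def by (auto split: if_splits)
qed

context adinkra
begin

text \<open>A functional vanishing on \<open>C\<close> is constant on cosets, so it grades the vertices of the quotient.
  Moving along color \<open>i\<close> adds a basis vector and changes the grade by the \<open>i\<close>-th coordinate of
  the functional.\<close>

lemma functional_grading:
  fixes \<phi> :: "bit ^ 'n \<Rightarrow> bit"
  assumes quot: "is_cube_quotient V E color C"
    and add: "\<And>x y. \<phi> (x + y) = \<phi> x + \<phi> y" and C0: "\<forall>c\<in>C. \<phi> c = 0"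
  shows "\<exists>g :: 'v \<Rightarrow> int. \<forall>v\<in>V. \<forall>i.
    g (nbr i v) = (if i \<in> {i. \<phi> (axis i 1) = 1} then 1 - g v else g v)"
proof -
  obtain f where f: "bij_betw f V (cosets C)"
    "\<forall>v\<in>V. \<forall>w\<in>V. \<forall>j. {v, w} \<in> E \<and> color {v, w} = j \<longleftrightarrow> quotient_adj C j (f v) (f w)"
    using quot unfolding is_cube_quotient_def by (elim exE conjE) (rule that; assumption)
  \<comment> \<open>By the next step any representative of the coset gives the same value.\<close>
  define \<gamma> where "\<gamma> v = \<phi> (SOME x. x \<in> f v)" for v
  have \<gamma>: "\<phi> x = \<gamma> v" if "v \<in> V" "x \<in> f v" for v x
  proof -
    have "f v \<in> cosets C"
      using f(1) that(1) by (auto dest: bij_betwE)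
    then obtain a where a: "f v = (+) a ` C"
      unfolding cosets_def by (rule imageE)
    have "\<phi> y = \<phi> a" if "y \<in> f v" for y
      using that C0 add unfolding a by auto
    from this[OF that(2)] this[OF someI[of "\<lambda>x. x \<in> f v"], OF that(2)] show ?thesis
      by (simp add: \<gamma>_def)
  qed
  have "\<gamma> (nbr i v) = \<gamma> v + \<phi> (axis i 1)" if v: "v \<in> V" for v i
  proof -
    have "quotient_adj C i (f v) (f (nbr i v))"
      using f(2) v nbr_in_V[OF v] nbr_edge[OF v] by blast
    then obtain x y where "x \<in> f v" "y \<in> f (nbr i v)" "y = x + axis i 1"
      unfolding quotient_adj_def cube_adj_iff by blast
    then show ?thesis
      using \<gamma> v nbr_in_V[OF v] add by metis
  qed
  then show ?thesis
    by (intro exI[of _ "\<lambda>v. if \<gamma> v = 1 then 1 else 0"]) auto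
qed

text \<open>For one color, \<open>N\<^sup>2 - N = 0\<close> and the complementary divisors carry no information, but the
  Laplacian is the 2 by 2 matrix with rows \<open>(1, - s)\<close> and \<open>(- s, 1)\<close>, which one row and one
  column operation diagonalize.\<close>

lemma invariant_factors_two_vertices:
  assumes V2: "card V = 2" and vs: "distinct vs" "set vs = V"
  shows "has_invariant_factors (signed_laplacian 1 E \<mu> vs) (replicate 1 1 @ replicate 1 0)"
proof -
  have "length vs = Suc (Suc 0)"
    using vs V2 by (metis distinct_card numeral_2_eq_2)
  then obtain a b where ab: "vs = [a, b]"
    by (auto simp: length_Suc_conv)
  obtain i :: 'n where True by simp
  have "nbr i a \<in> V" "nbr i a \<noteq> a"
    using nbr_edge[of a i] edge_vertices[of a "nbr i a"] vs(2) ab by auto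
  then have "nbr i a = b" using vs(2) ab by auto
  then have E: "{a, b} \<in> E" using nbr_edge[of a i] vs(2) ab by auto
  define s where "s = \<mu> {a, b}"
  have s: "s * s = 1" using signature[OF E] by (auto simp: s_def)
  have loops: "{a} \<notin> E" "{b} \<notin> E"
    using edge_vertices[of a a] edge_vertices[of b b] by auto
  define L where "L = signed_laplacian 1 E \<mu> vs"
  have L: "L = Matrix.mat 2 2 (\<lambda>(i, j). if i = j then 1 else - s)"
    unfolding L_def signed_laplacian_def signed_adjacency_def ab
    by (rule eq_matI) (auto simp: less_2_cases_iff E loops s_def insert_commute numeral_2_eq_2 less_Suc_eq)
  have Lc: "L \<in> carrier_mat 2 2" unfolding L by simp
  have "unimod_equiv 2 L (addcol s 1 0 (addrow s 1 0 L))"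
    by (intro unimod_equiv_addcol[OF Lc] unimod_equiv_addrow[OF Lc] unimod_equiv_refl[OF Lc]) auto
  also have "addcol s 1 0 (addrow s 1 0 L) = mat_diag 2 (\<lambda>i. if i < 1 then 1 else 0)"
    by (rule eq_matI) (auto simp: L mat_diag_def less_2_cases_iff s)
  finally show ?thesis
    using has_invariant_factors_two_blocks[of L 1 0] Lc unfolding L_def by simp
qed

text \<open>For one color, the only nonzero word is the all-ones word, so \<open>C\<close> is trivial and the quotient
  is the 1-cube.\<close>

lemma card_single_color:
  assumes N: "CARD('n) = 1" and C: "vec.subspace C" "(\<chi> i. 1) \<notin> C"
    and quot: "is_cube_quotient V E color (C :: (bit ^ 'n) set)"
  shows "card V = 2"
proof -
  obtain k :: 'n where k: "UNIV = {k}"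
    using N by (auto simp: card_1_singleton_iff)
  have "c = 0" if "c \<in> C" for c
  proof (rule ccontr)
    assume "c \<noteq> 0"
    then have "c $ k \<noteq> 0" using k by (metis UNIV_I singletonD Finite_Cartesian_Product.vec_eq_iff zero_index)
    then have "c = (\<chi> i. 1)" using k by (metis UNIV_I singletonD Finite_Cartesian_Product.vec_eq_iff vec_lambda_beta bit_not_zero_iff)
    then show False using that C by simp
  qed
  then have "C = {0}" using vec.subspace_0[OF C(1)] by blast
  then have "cosets C = range (\<lambda>x. {x})" by (simp add: cosets_def)
  then have "card (cosets C) = CARD(bit ^ 'n)"
    by (simp add: card_image)
  moreover have "(UNIV :: bit set) = {0, 1}"
    by (auto intro: bit.exhaust)
  then have "CARD(bit) = card {0, 1 :: bit}"
    by (rule arg_cong)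
  ultimately have "card (cosets C) = 2" by (simp add: N)
  then show ?thesis
    using quot unfolding is_cube_quotient_def by (auto dest: bij_betw_same_card)
qed

end

section \<open>Invariant factors of cube quotients\<close>

theorem corollary40:
  fixes V :: "'v set" and E :: "'v set set" and \<mu> :: "'v set \<Rightarrow> int"
    and color :: "'v set \<Rightarrow> 'n::finite" and h :: "'v \<Rightarrow> int"
    and C :: "(bit ^ 'n) set" and vs :: "'v list" and N :: nat
  assumes "N = CARD('n)"
    and "adinkra V E \<mu> color h"
    and "doubly_even_code C"
    and "(\<chi> i. 1) \<notin> C"
    and "is_cube_quotient V E color C"
    and "distinct vs" and "set vs = V"
  shows "has_invariant_factors (signed_laplacian N E \<mu> vs)
           (replicate (card V div 2) 1 @ replicate (card V div 2) (int N ^ 2 - int N))"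
proof -
  interpret adinkra V E \<mu> color h by fact
  have C: "vec.subspace C"
    using assms(3) by (simp add: doubly_even_code_def)
  have len: "length vs = card V"
    using assms(6,7) distinct_card by metis
  show ?thesis
  proof (cases "N = 1")
    case True
    then have V2: "card V = 2"
      using card_single_color[OF _ C assms(4,5)] assms(1) by simp
    show ?thesis
      using invariant_factors_two_vertices[OF V2 assms(6,7)] assms(1)[symmetric]
      unfolding True V2 by simp
  next
    case False
    then have N: "CARD('n) \<ge> 2"
      using assms(1) zero_less_card_finite[where 'a = 'n] by linarith
    obtain \<phi> :: "bit ^ 'n \<Rightarrow> bit" where \<phi>: "\<And>x y. \<phi> (x + y) = \<phi> x + \<phi> y"
      "\<forall>c\<in>C. \<phi> c = 0" "\<phi> (\<chi> i. 1) = 1"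
      by (rule separating_functional[OF C assms(4)]) blast
    obtain g :: "'v \<Rightarrow> int" where g: "\<forall>v\<in>V. \<forall>i.
        g (nbr i v) = (if i \<in> {i. \<phi> (axis i 1) = 1} then 1 - g v else g v)"
      using functional_grading[OF assms(5), of \<phi>, OF \<phi>(1,2)] by (elim exE) (rule that)
    obtain b :: "'v \<Rightarrow> int" where b: "\<forall>v. b v \<in> {-1, 1}" "\<forall>v\<in>V. \<forall>i. b (nbr i v) = - b v"
      using bipartite_sign by (elim exE conjE) (rule that)
    have "has_invariant_factors
        (int CARD('n) \<cdot>\<^sub>m 1\<^sub>m (length vs) - op_mat vs (step UNIV))
        (replicate (length vs div 2) 1 @
         replicate (length vs div 2) (int CARD('n) ^ 2 - int CARD('n)))"
      by (rule step_smith_form[OF assms(6,7) N odd_support_of_functional[of \<phi>, OF \<phi>(1,3)], of g b])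
        (use g b in simp_all)
    then show ?thesis
      by (simp only: op_mat_step[OF assms(7)] signed_laplacian_def len assms(1))
  qed
qed

end
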